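(* Let $\mu$ be a finite Borel measure on $(-\pi,\pi)$ and let $\mu^\#$ be its symmetrization. Let $u_\mu$ and $u_{\mu^\#}$ be the corresponding solutions of the Dirichlet problem $-u''=\mu$ on $(-\pi,\pi)$ in the sense of distributions, $u(-\pi)=u(\pi)=0$. Then \[\int_{-\pi}^{\pi}\phi\bigl(u_\mu(x)\bigr)\,dx\le\int_{-\pi}^{\pi}\phi\bigl(u_{\mu^\#}(x)\bigr)\,dx\] for every convex and increasing function $\phi:\mathbb{R}\to\mathbb{R}$. Moreover, if $\phi$ is strictly convex (and increasing), equality holds if and only if the Radon–Nikodym derivative $f$ of $\mu$ equals its symmetric decreasing rearrangement $f^\#$ a.e. on $(-\pi,\pi)$ and the singular part of $\mu$ is a (nonnegative multiple of a) Dirac mass at the origin, i.e. if and only if $\mu=\mu^\#$.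
   Context: A "Borel measure on $(-\pi,\pi)$" means a positive measure on the Borel $\sigma$-algebra of $(-\pi,\pi)$ that is not the zero measure; $\lambda$ is Lebesgue measure. Green's function: $G(x,y)=-\frac{xy}{2\pi}-\frac12|x-y|+\frac{\pi}{2}$ for $x,y\in[-\pi,\pi]$. For a finite Borel measure $\mu$ on $(-\pi,\pi)$, $u_\mu(x)=\int_{-\pi}^{\pi}G(x,y)\,d\mu(y)$; this is the unique absolutely continuous function on $[-\pi,\pi]$ with $-u_\mu''=\mu$ in the sense of distributions on $(-\pi,\pi)$ and $u_\mu(\pm\pi)=0$. Every finite Borel measure $\mu$ on $(-\pi,\pi)$ decomposes uniquely as $\mu=\nu+\sigma+\delta$, where $\nu\ll\lambda$ with $d\nu=f\,d\lambda$ for some $0\le f\in L^1[-\pi,\pi]$ (the Radon–Nikodym derivative of $\mu$), $\sigma\perp\lambda$ has no atoms, and $\delta=\sum_i a_i\delta_{x_i}$ is purely discontinuous (distinct points $x_i\in(-\pi,\pi)$, $a_i\ge0$, $\sum a_i<\infty$); the singular part of $\mu$ is $\sigma+\delta$. Decreasing rearrangement of $f\in L^1[-\pi,\pi]$: $f^*(0)=\operatorname{ess\,sup}f$, $f^*(2\pi)=\operatorname{ess\,inf}f$, and $f^*(t)=\inf\{s\in\mathbb{R}:\lambda(\{x\in[-\pi,\pi]:f(x)>s\})\le t\}$ for $t\in(0,2\pi)$; the symmetric decreasing rearrangement is $f^\#(t)=f^*(2|t|)$, $t\in[-\pi,\pi]$. The symmetrization of $\mu$ is the measure $\mu^\#$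 with $d\mu^\#=f^\#\,d\lambda+M\,d\delta_0$, where $M=\sigma((-\pi,\pi))+\delta((-\pi,\pi))$ and $\delta_0$ is the unit Dirac mass at $0$. *)

theory Defs
  imports "HOL-Probability.Probability"
begin

text \<open>Green's function of -u'' on (-pi,pi) with Dirichlet boundary conditions.\<close>
definition green :: "real \<Rightarrow> real \<Rightarrow> real" where
  "green x y = - (x * y) / (2 * pi) - \<bar>x - y\<bar> / 2 + pi / 2"

definition u_meas :: "real measure \<Rightarrow> real \<Rightarrow> real" where
  "u_meas M x = (\<integral>y. green x y \<partial>M)"

definition borel_I :: "real measure" where
  "borel_I = restrict_space borel {-pi<..<pi}"

text \<open>Lebesgue decomposition data of M: f is the density of the absolutely
  continuous part (Radon-Nikodym derivative) and the singular part sigma+delta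
  is concentrated on the Lebesgue null Borel set N, i.e. it is A |-> M (A \<inter> N).\<close>
definition lebesgue_decomp :: "real measure \<Rightarrow> (real \<Rightarrow> real) \<Rightarrow> real set \<Rightarrow> bool" where
  "lebesgue_decomp M f N \<longleftrightarrow>
     f \<in> borel_measurable lborel \<and> (\<forall>x. 0 \<le> f x) \<and>
     set_integrable lborel {-pi..pi} f \<and>
     N \<in> sets borel \<and> N \<subseteq> {-pi<..<pi} \<and> emeasure lborel N = 0 \<and>
     (\<forall>A \<in> sets M. emeasure M A = (\<integral>\<^sup>+x\<in>A. ennreal (f x) \<partial>lborel) + emeasure M (A \<inter> N))"

definition dec_rearr :: "(real \<Rightarrow> real) \<Rightarrow> real \<Rightarrow> real" where
  "dec_rearr f t =
     (if t = 0 then real_of_ereal (esssup (restrict_space lborel {-pi..pi}) (\<lambda>x. ereal (f x)))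
      else if t = 2 * pi then
        real_of_ereal (- esssup (restrict_space lborel {-pi..pi}) (\<lambda>x. - ereal (f x)))
      else Inf {s. measure lborel {x \<in> {-pi..pi}. f x > s} \<le> t})"

definition strict_convex_on :: "real set \<Rightarrow> (real \<Rightarrow> real) \<Rightarrow> bool" where
  "strict_convex_on A \<phi> \<longleftrightarrow> convex A \<and>
     (\<forall>x\<in>A. \<forall>y\<in>A. \<forall>t. x \<noteq> y \<and> 0 < t \<and> t < 1 \<longrightarrow>
        \<phi> ((1 - t) * x + t * y) < (1 - t) * \<phi> x + t * \<phi> y)"

definition sym_rearr :: "(real \<Rightarrow> real) \<Rightarrow> real \<Rightarrow> real" where
  "sym_rearr f t = dec_rearr f (2 * \<bar>t\<bar>)"

text \<open>Symmetrization mu^#: d mu^# = f^# d lambda + Ms d delta_0, Ms the total singular mass.\<close>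
definition sym_meas :: "(real \<Rightarrow> real) \<Rightarrow> real \<Rightarrow> real measure" where
  "sym_meas f Ms = measure_of {-pi<..<pi} (sets borel_I)
     (\<lambda>A. (\<integral>\<^sup>+x\<in>A. ennreal (sym_rearr f x) \<partial>lborel) + ennreal Ms * indicator A 0)"

end

theory Submission
  imports Defs
begin

text \<open>
  For \<open>-\<pi> < a \<le> b < \<pi>\<close> a suitable convex combination of the two hats \<open>G(a,\<cdot>)\<close> and \<open>G(b,\<cdot>)\<close> is
  constant on \<open>[a,b]\<close>, so it is a multiple of a trapezoid. Since \<open>\<mu>\<close> gives an interval at most
  the mass that \<open>\<mu>\<^sup>#\<close> gives the centred interval of the same length, integrating over superlevel
  sets shows that the trapezoid has a larger \<open>\<mu>\<^sup>#\<close>-integral once it is centred, and by AM-GM the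
  centred trapezoid is also the tallest. This is Talenti's pointwise comparison
  \<open>min (u\<^sub>\<mu> a) (u\<^sub>\<mu> b) \<le> u\<^sub>\<mu>\<^sub># ((b - a) / 2)\<close>, with equality only for \<open>a = - b\<close>. Hence the superlevel
  sets of \<open>u\<^sub>\<mu>\<close> are no longer than those of \<open>u\<^sub>\<mu>\<^sub>#\<close>, which gives the inequality for every
  increasing \<open>\<phi>\<close>. For strictly increasing \<open>\<phi>\<close> equality of the integrals forces the two potentials
  to agree, and a potential determines its measure.
\<close>

subsection \<open>Level sets and rearrangement\<close>

text \<open>Tonelli for the indicator of the region \<open>0 \<le> t < g x\<close> under the graph;
  \<open>ennreal\<close> already cuts negative values of \<open>g\<close> off at 0.\<close>

lemma nn_integral_layer_cake:
  fixes g :: "'a \<Rightarrow> real"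
  assumes "sigma_finite_measure M" and [measurable]: "g \<in> borel_measurable M"
  shows "(\<integral>\<^sup>+x. ennreal (g x) \<partial>M) = 
    (\<integral>\<^sup>+t. emeasure M {x \<in> space M. t < g x} * indicator {0..} t \<partial>lborel)"
proof -
  interpret M: sigma_finite_measure M by fact
  interpret pair_sigma_finite M lborel ..
  have "(\<integral>\<^sup>+x. ennreal (g x) \<partial>M)
      = (\<integral>\<^sup>+x. (\<integral>\<^sup>+t. indicator {z \<in> space (M \<Otimes>\<^sub>M lborel). 0 \<le> snd z \<and> snd z < g (fst z)} (x, t) \<partial>lborel) \<partial>M)"
  proof (rule nn_integral_cong)
    fix x assume x: "x \<in> space M"
    have "(\<integral>\<^sup>+t. indicator {z \<in> space (M \<Otimes>\<^sub>M lborel). 0 \<le> snd z \<and> snd z < g (fst z)} (x, t) \<partial>lborel)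
        = (\<integral>\<^sup>+t. indicator {0..<g x} t \<partial>lborel)"
      using x by (intro nn_integral_cong) (auto simp: indicator_def space_pair_measure)
    then show "ennreal (g x) = (\<integral>\<^sup>+t. indicator {z \<in> space (M \<Otimes>\<^sub>M lborel). 0 \<le> snd z \<and> snd z < g (fst z)} (x, t) \<partial>lborel)"
      by (cases "0 \<le> g x") (auto simp: ennreal_neg)
  qed
  also have "\<dots> = (\<integral>\<^sup>+t. (\<integral>\<^sup>+x. indicator {z \<in> space (M \<Otimes>\<^sub>M lborel). 0 \<le> snd z \<and> snd z < g (fst z)} (x, t) \<partial>M) \<partial>lborel)"
    by (rule Fubini'[symmetric]) measurable
  also have "\<dots> = (\<integral>\<^sup>+t. emeasure M {x \<in> space M. t < g x} * indicator {0..} t \<partial>lborel)"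
  proof (rule nn_integral_cong)
    fix t :: real
    have "(\<integral>\<^sup>+x. indicator {z \<in> space (M \<Otimes>\<^sub>M lborel). 0 \<le> snd z \<and> snd z < g (fst z)} (x, t) \<partial>M)
        = (\<integral>\<^sup>+x. indicator {x \<in> space M. t < g x} x * indicator {0..} t \<partial>M)"
      by (intro nn_integral_cong) (auto simp: indicator_def space_pair_measure)
    also have "\<dots> = emeasure M {x \<in> space M. t < g x} * indicator {0..} t"
      by (simp add: nn_integral_multc)
    finally show "(\<integral>\<^sup>+x. indicator {z \<in> space (M \<Otimes>\<^sub>M lborel). 0 \<le> snd z \<and> snd z < g (fst z)} (x, t) \<partial>M) = \<dots>" .
  qed
  finally show ?thesis .
qed

text \<open>The two functions may live on different measure spaces, so this also compares integrals
  against a measure and against its symmetrization.\<close>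

lemma nn_integral_mono_superlevel:
  fixes g :: "'a \<Rightarrow> real" and g' :: "'b \<Rightarrow> real"
  assumes "sigma_finite_measure M" "g \<in> borel_measurable M"
    and "sigma_finite_measure M'" "g' \<in> borel_measurable M'"
    and "\<And>t. 0 \<le> t \<Longrightarrow> emeasure M {x \<in> space M. t < g x} \<le> emeasure M' {x \<in> space M'. t < g' x}"
  shows "(\<integral>\<^sup>+x. ennreal (g x) \<partial>M) \<le> (\<integral>\<^sup>+x. ennreal (g' x) \<partial>M')"
  unfolding nn_integral_layer_cake[OF assms(1,2)] nn_integral_layer_cake[OF assms(3,4)]
  using assms(5) by (intro nn_integral_mono) (auto simp: indicator_def)

lemma sets_borel_I_iff: "A \<in> sets borel_I \<longleftrightarrow> A \<in> sets borel \<and> A \<subseteq> {-pi<..<pi}"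
  unfolding borel_I_def by (subst sets_restrict_space_iff) auto

lemma space_borel_I: "space borel_I = {-pi<..<pi}"
  by (simp add: borel_I_def space_restrict_space)

text \<open>Drops the junk values of \<open>sym_rearr\<close>: at 0 an infinite essential supremum is cut to 0, and
  outside \<open>[-\<pi>,\<pi>]\<close> the infimum is taken over an unbounded set.\<close>

definition sym_density :: "(real \<Rightarrow> real) \<Rightarrow> real \<Rightarrow> real" where
  "sym_density f x = (if x \<noteq> 0 \<and> \<bar>x\<bar> < pi then sym_rearr f x else 0)"

text \<open>The distribution function of \<open>f\<close> on the interval.\<close>

definition superlevel_length :: "(real \<Rightarrow> real) \<Rightarrow> real \<Rightarrow> real" where
  "superlevel_length f s = measure lborel {x \<in> {-pi..pi}. f x > s}"

locale integrable_density =
  fixes f :: "real \<Rightarrow> real"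
  assumes meas_f [measurable]: "f \<in> borel_measurable borel"
    and f_nonneg: "\<And>x. 0 \<le> f x"
    and f_int: "set_integrable lborel {-pi..pi} f"
begin

lemma fmeasurable_superlevel: "{x \<in> {-pi..pi}. f x > s} \<in> fmeasurable lborel"
proof (rule fmeasurableI2)
  show "{-pi..pi} \<in> fmeasurable lborel" by (auto simp: fmeasurable_def)
qed auto

lemma emeasure_superlevel:
  "emeasure lborel {x \<in> {-pi..pi}. f x > s} = ennreal (superlevel_length f s)"
  unfolding superlevel_length_def
  using fmeasurable_superlevel by (simp add: emeasure_eq_measure2)

lemma superlevel_length_antimono: "s \<le> s' \<Longrightarrow> superlevel_length f s' \<le> superlevel_length f s"
  unfolding superlevel_length_def
  by (rule measure_mono_fmeasurable) (use fmeasurable_superlevel in auto)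

lemma superlevel_length_le: "superlevel_length f s \<le> 2 * pi"
proof -
  have "superlevel_length f s \<le> measure lborel {-pi..pi}"
    unfolding superlevel_length_def by (rule measure_mono_fmeasurable) (auto simp: fmeasurable_def)
  then show ?thesis by simp
qed

lemma superlevel_length_nonneg: "0 \<le> superlevel_length f s"
  unfolding superlevel_length_def by simp

lemma superlevel_length_neg: "s < 0 \<Longrightarrow> superlevel_length f s = 2 * pi"
proof -
  assume "s < 0"
  then have "{x \<in> {-pi..pi}. f x > s} = {-pi..pi}" using f_nonneg by (auto intro: less_le_trans)
  then show ?thesis by (simp add: superlevel_length_def)
qed

text \<open>Continuity from below along the increasing sets
  \<open>f x > s + 1 / real (Suc n)\<close>.\<close>

lemma superlevel_length_right_continuous:
  "(\<lambda>n. superlevel_length f (s + 1 / real (Suc n))) \<longlonglongrightarrow> superlevel_length f s"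
proof -
  have eq: "{x \<in> {-pi..pi}. f x > s} = (\<Union>n. {x \<in> {-pi..pi}. f x > s + 1 / real (Suc n)})" (is "?L = ?R")
  proof (intro equalityI subsetI)
    fix x assume "x \<in> ?L"
    moreover then obtain n where "1 / real (Suc n) < f x - s"
      using nat_approx_posE[of "f x - s"] by auto
    ultimately show "x \<in> ?R" by (auto simp: algebra_simps)
  next
    fix x assume "x \<in> ?R"
    then obtain n where "x \<in> {-pi..pi}" "f x > s + 1 / real (Suc n)" by auto
    moreover have "1 / real (Suc n) > 0" by simp
    ultimately show "x \<in> ?L" by (smt (verit) mem_Collect_eq)
  qed
  have "(\<lambda>n. emeasure lborel {x \<in> {-pi..pi}. f x > s + 1 / real (Suc n)}) 
      \<longlonglongrightarrow> emeasure lborel (\<Union>n. {x \<in> {-pi..pi}. f x > s + 1 / real (Suc n)})"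
  proof (rule Lim_emeasure_incseq)
    show "incseq (\<lambda>n. {x \<in> {-pi..pi}. f x > s + 1 / real (Suc n)})"
    proof (rule incseq_SucI, rule subsetI)
      fix n x assume "x \<in> {x \<in> {-pi..pi}. f x > s + 1 / real (Suc n)}"
      moreover have "1 / real (Suc (Suc n)) \<le> 1 / real (Suc n)" by (simp add: field_simps)
      ultimately show "x \<in> {x \<in> {-pi..pi}. f x > s + 1 / real (Suc (Suc n))}" by auto
    qed
  qed (auto intro!: measurable_sets)
  then show ?thesis
    unfolding eq[symmetric] emeasure_superlevel
    by (subst (asm) tendsto_ennreal_iff) (auto simp: superlevel_length_nonneg)
qed

text \<open>Markov's inequality. It makes the set whose infimum is the rearrangement
  nonempty.\<close>

lemma superlevel_length_eventually_small:
  assumes "0 < t" shows "\<exists>s. superlevel_length f s \<le> t"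
proof -
  define I where "I = (LINT x:{-pi..pi}|lborel. f x)"
  have I0: "0 \<le> I" unfolding I_def set_lebesgue_integral_def
    by (rule integral_nonneg_AE) (auto simp: f_nonneg)
  \<comment> \<open>Chosen so that the Markov bound \<open>I / s\<close> is at most
    \<open>t\<close>; the summand 1 keeps \<open>s\<close> positive when
    \<open>I = 0\<close>.\<close>
  define s where "s = (I + 1) / t"
  have s: "s > 0" using I0 assms by (simp add: s_def)
  have "superlevel_length f s \<le> measure lborel {x \<in> space lborel. indicator {-pi..pi} x *\<^sub>R f x \<ge> s}"
    unfolding superlevel_length_def
  proof (rule measure_mono_fmeasurable)
    show "{x \<in> space lborel. s \<le> indicat_real {- pi..pi} x *\<^sub>R f x} \<in> fmeasurable lborel"
    proof (rule fmeasurableI2[of "{-pi..pi}"])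
      show "{x \<in> space lborel. s \<le> indicat_real {- pi..pi} x *\<^sub>R f x} \<subseteq> {-pi..pi}"
        using s by (auto simp: indicator_def split: if_splits)
    qed (auto simp: fmeasurable_def)
  qed (auto simp: indicator_def)
  also have "\<dots> \<le> I / s"
    unfolding I_def set_lebesgue_integral_def
    by (rule integral_Markov_inequality_measure[where A="{}"])
      (use s f_int f_nonneg in \<open>auto simp: set_integrable_def\<close>)
  also have "\<dots> \<le> t" using I0 assms by (simp add: s_def field_simps)
  finally show ?thesis by blast
qed

text \<open>A decreasing right-continuous function and its generalized inverse form a Galois
  connection. The assumptions put \<open>2 * \<bar>x\<bar>\<close> strictly between 0 and
  \<open>2 * pi\<close>, where \<open>dec_rearr\<close> is given by the infimum.\<close>

lemma sym_rearr_gt_iff: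
  assumes x: "x \<noteq> 0" "\<bar>x\<bar> < pi"
  shows "t < sym_rearr f x \<longleftrightarrow> 2 * \<bar>x\<bar> < superlevel_length f t"
proof -
  define S where "S = {s. superlevel_length f s \<le> 2 * \<bar>x\<bar>}"
  have eq: "sym_rearr f x = Inf S"
    using x by (simp add: sym_rearr_def dec_rearr_def S_def superlevel_length_def)
  have "S \<noteq> {}" using superlevel_length_eventually_small[of "2 * \<bar>x\<bar>"] x by (auto simp: S_def)
  have lower: "\<And>s. s \<in> S \<Longrightarrow> 0 \<le> s"
    using superlevel_length_neg x by (fastforce simp: S_def not_less[symmetric])
  then have bdd: "bdd_below S" by (auto simp: bdd_below_def)
  show ?thesis
  proof
    assume "t < sym_rearr f x"
    then have "t \<notin> S" using cInf_lower[OF _ bdd] by (force simp: eq)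
    then show "2 * \<bar>x\<bar> < superlevel_length f t" by (simp add: S_def)
  next
    assume "2 * \<bar>x\<bar> < superlevel_length f t"
    \<comment> \<open>Right continuity yields a level strictly above \<open>t\<close> that still
      bounds \<open>S\<close> from below.\<close>
    then have "\<forall>\<^sub>F n in sequentially. 2 * \<bar>x\<bar> < superlevel_length f (t + 1 / real (Suc n))"
      using superlevel_length_right_continuous order_tendstoD(1) by blast
    then obtain n where n: "2 * \<bar>x\<bar> < superlevel_length f (t + 1 / real (Suc n))"
      by (auto simp: eventually_sequentially)
    have "t + 1 / real (Suc n) \<le> Inf S"
    proof (rule cInf_greatest)
      fix s assume "s \<in> S"
      then show "t + 1 / real (Suc n) \<le> s"
        using n superlevel_length_antimono[of s "t + 1 / real (Suc n)"] 
        by (force simp: S_def)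
    qed fact
    moreover have "1 / real (Suc n) > 0" by simp
    ultimately show "t < sym_rearr f x" unfolding eq by linarith
  qed
qed

lemma sym_density_gt_iff:
  assumes "0 \<le> t"
  shows "t < sym_density f x \<longleftrightarrow> x \<noteq> 0 \<and> 2 * \<bar>x\<bar> < superlevel_length f t"
  using assms sym_rearr_gt_iff[of x t] superlevel_length_le[of t]
  by (auto simp: sym_density_def)

lemma sym_density_nonneg: "0 \<le> sym_density f x"
proof (cases "x \<noteq> 0 \<and> \<bar>x\<bar> < pi")
  case True
  then have "\<And>t. t < 0 \<Longrightarrow> t < sym_density f x"
    using sym_rearr_gt_iff[of x] superlevel_length_neg by (simp add: sym_density_def)
  then show ?thesis by (meson dense_le less_imp_le)
qed (auto simp: sym_density_def)

lemma sym_density_measurable [measurable]: "sym_density f \<in> borel_measurable borel"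
proof (rule borel_measurable_iff_greater[THEN iffD2], rule allI)
  fix t :: real
  show "{x \<in> space borel. t < sym_density f x} \<in> sets borel"
  proof (cases "0 \<le> t")
    case True
    then show ?thesis by (simp add: sym_density_gt_iff)
  next
    case False
    then have "{x \<in> space borel. t < sym_density f x} = UNIV"
      using sym_density_nonneg by (auto simp: not_le intro: less_le_trans)
    then show ?thesis by simp
  qed
qed

text \<open>The superlevel set is a centred interval without the point 0, so up to that point it is
  nested with \<open>{-s<..<s}\<close>.\<close>

lemma emeasure_sym_density_superlevel:
  assumes "0 \<le> t" "0 \<le> s"
  shows "emeasure lborel ({-s<..<s} \<inter> {x. t < sym_density f x}) 
    = ennreal (min (2 * s) (superlevel_length f t))"
proof -
  define m where "m = min s (superlevel_length f t / 2)"
  have m: "0 \<le> m" using assms superlevel_length_nonneg[of t] by (simp add: m_def)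
  have "{-s<..<s} \<inter> {x. t < sym_density f x} = {-m<..<m} - {0}"
    by (auto simp: sym_density_gt_iff[OF assms(1)] m_def)
  then have "emeasure lborel ({-s<..<s} \<inter> {x. t < sym_density f x}) = emeasure lborel {-m<..<m}"
    by (simp add: emeasure_Diff_null_set null_sets_def)
  also have "\<dots> = ennreal (2 * m)" using m by simp
  also have "2 * m = min (2 * s) (superlevel_length f t)" by (auto simp: m_def)
  finally show ?thesis .
qed

text \<open>At each level, the part of a superlevel set of \<open>f\<close> inside
  \<open>{a<..<b}\<close> is no longer than the interval or than the whole superlevel set; the
  centred configuration attains the smaller of these lengths.\<close>

lemma set_nn_integral_interval_le_sym_density:
  assumes "-pi \<le> a" "b \<le> pi" "b - a = 2 * s" "0 \<le> s"
  shows "(\<integral>\<^sup>+x\<in>{a<..<b}. ennreal (f x) \<partial>lborel) \<le> (\<integral>\<^sup>+x\<in>{-s<..<s}. ennreal (sym_density f x) \<partial>lborel)"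
proof -
  have *: "(\<integral>\<^sup>+x\<in>A. ennreal (g x) \<partial>lborel) = (\<integral>\<^sup>+x. ennreal (g x * indicator A x) \<partial>lborel)" 
    for g :: "real \<Rightarrow> real" and A
    by (intro nn_integral_cong) (auto simp: indicator_def)
  show ?thesis unfolding *
  proof (rule nn_integral_mono_superlevel)
    fix t :: real assume t: "0 \<le> t"
    have 1: "{x \<in> space lborel. t < f x * indicator {a<..<b} x} = {a<..<b} \<inter> {x. t < f x}"
      "{x \<in> space lborel. t < sym_density f x * indicator {-s<..<s} x} = {-s<..<s} \<inter> {x. t < sym_density f x}"
      using t by (auto simp: indicator_def split: if_splits)
    have "emeasure lborel ({a<..<b} \<inter> {x. t < f x}) \<le> emeasure lborel {a<..<b}"
      by (rule emeasure_mono) auto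
    moreover have "emeasure lborel {a<..<b} = ennreal (2 * s)" using assms by simp
    moreover have "emeasure lborel ({a<..<b} \<inter> {x. t < f x}) \<le> emeasure lborel {x \<in> {-pi..pi}. t < f x}"
      by (rule emeasure_mono) (use assms in auto)
    moreover have "\<dots> = ennreal (superlevel_length f t)" by (rule emeasure_superlevel)
    ultimately have "emeasure lborel ({a<..<b} \<inter> {x. t < f x}) \<le> ennreal (min (2 * s) (superlevel_length f t))"
      by (simp add: min_def)
    then show "emeasure lborel {x \<in> space lborel. t < f x * indicator {a<..<b} x}
        \<le> emeasure lborel {x \<in> space lborel. t < sym_density f x * indicator {-s<..<s} x}"
      unfolding 1 by (simp add: emeasure_sym_density_superlevel[OF t assms(4)])
  qed (auto intro: sigma_finite_lborel)
qed

text \<open>Equimeasurability: at every level \<open>t \<ge> 0\<close> the superlevel sets of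
  \<open>sym_density f\<close> and \<open>f\<close> have the same length.\<close>

lemma nn_integral_sym_density_finite: "(\<integral>\<^sup>+x. ennreal (sym_density f x) \<partial>lborel) < \<infinity>"
proof -
  have "(\<integral>\<^sup>+x. ennreal (sym_density f x) \<partial>lborel) \<le> (\<integral>\<^sup>+x. ennreal (indicator {-pi..pi} x * f x) \<partial>lborel)"
  proof (rule nn_integral_mono_superlevel)
    fix t :: real assume t: "0 \<le> t"
    have "{x \<in> space lborel. t < sym_density f x} = {-pi<..<pi} \<inter> {x. t < sym_density f x}"
      using t by (auto simp: sym_density_def split: if_splits)
    then have "emeasure lborel {x \<in> space lborel. t < sym_density f x} = ennreal (superlevel_length f t)"
      using emeasure_sym_density_superlevel[OF t, of pi] superlevel_length_le[of t] 
      by (simp add: min_absorb2)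
    also have "\<dots> = emeasure lborel {x \<in> space lborel. t < indicator {-pi..pi} x * f x}"
      unfolding emeasure_superlevel[symmetric] using t
      by (intro arg_cong[where f="emeasure lborel"]) (auto simp: indicator_def split: if_splits)
    finally show "emeasure lborel {x \<in> space lborel. t < sym_density f x} \<le> \<dots>" by simp
  qed (auto intro: sigma_finite_lborel)
  also have "\<dots> < \<infinity>"
    using f_int f_nonneg unfolding set_integrable_def 
    by (auto simp: integrable_iff_bounded)
  finally show ?thesis .
qed

section \<open>The symmetrized measure and its reflection symmetry\<close>

lemma set_nn_integral_sym_rearr:
  assumes "A \<subseteq> {-pi<..<pi}"
  shows "(\<integral>\<^sup>+x\<in>A. ennreal (sym_rearr f x) \<partial>lborel) = (\<integral>\<^sup>+x\<in>A. ennreal (sym_density f x) \<partial>lborel)"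
proof (rule nn_integral_cong_AE)
  show "AE x in lborel. ennreal (sym_rearr f x) * indicator A x = ennreal (sym_density f x) * indicator A x"
    \<comment> \<open>Inside the interval the two densities can differ only at 0.\<close>
    using AE_lborel_singleton[of 0]
  proof eventually_elim
    case (elim x)
    then show ?case using assms by (force simp: sym_density_def indicator_def abs_less_iff)
  qed
qed

lemma sets_sym_meas: "sets (sym_meas f c) = sets borel_I"
  using sets.sigma_sets_eq[of borel_I] sets.space_closed[of borel_I]
  by (simp add: sym_meas_def space_borel_I)

lemma space_sym_meas: "space (sym_meas f c) = {-pi<..<pi}"
  using sets_eq_imp_space_eq[OF sets_sym_meas] by (simp add: space_borel_I)

text \<open>\<open>measure_of\<close> takes the prescribed values only if they are countably
  additive. Here they are the sum of a density measure and a multiple of a Dirac measure.\<close>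

lemma emeasure_sym_meas:
  assumes A: "A \<in> sets borel_I"
  shows "emeasure (sym_meas f c) A 
    = (\<integral>\<^sup>+x\<in>A. ennreal (sym_density f x) \<partial>lborel) + ennreal c * indicator A 0"
proof -
  let ?D = "density lborel (\<lambda>x. ennreal (sym_density f x))"
  let ?m = "\<lambda>A. (\<integral>\<^sup>+x\<in>A. ennreal (sym_rearr f x) \<partial>lborel) + ennreal c * indicator A 0"
  have m: "?m A = emeasure ?D A + ennreal c * emeasure (return borel 0) A" if "A \<in> sets borel_I" for A
    using that by (simp add: sets_borel_I_iff emeasure_density set_nn_integral_sym_rearr)
  have sig: "sigma_sets {-pi<..<pi} (sets borel_I) = sets borel_I"
    using sets.sigma_sets_eq[of borel_I] by (simp add: space_borel_I)
  have "emeasure (sym_meas f c) A = ?m A"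
    unfolding sym_meas_def
  proof (rule emeasure_measure_of_sigma)
    show "sigma_algebra {-pi<..<pi} (sets borel_I)"
      using sets.sigma_algebra_axioms[of borel_I] by (simp add: space_borel_I)
    show "positive (sets borel_I) ?m" by (simp add: positive_def)
    show "countably_additive (sets borel_I) ?m"
    proof (rule countably_additiveI)
      fix A :: "nat \<Rightarrow> real set"
      assume A: "range A \<subseteq> sets borel_I" "disjoint_family A" "(\<Union>i. A i) \<in> sets borel_I"
      have b: "range A \<subseteq> sets borel" using A(1) by (auto simp: sets_borel_I_iff)
      have "(\<Sum>i. ?m (A i)) = (\<Sum>i. emeasure ?D (A i) + ennreal c * emeasure (return borel 0) (A i))"
        using A(1) by (intro suminf_cong m) auto
      also have "\<dots> = (\<Sum>i. emeasure ?D (A i)) + ennreal c * (\<Sum>i. emeasure (return borel 0) (A i))"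
        by (simp only: suminf_add[symmetric, OF summableI summableI] ennreal_suminf_cmult)
      also have "\<dots> = emeasure ?D (\<Union>i. A i) + ennreal c * emeasure (return borel 0) (\<Union>i. A i)"
        using suminf_emeasure[of A ?D] suminf_emeasure[of A "return borel 0"] A b by simp
      also have "\<dots> = ?m (\<Union>i. A i)" using m[OF A(3)] by simp
      finally show "(\<Sum>i. ?m (A i)) = ?m (\<Union>i. A i)" .
    qed
  qed fact
  then show ?thesis using A by (simp add: sets_borel_I_iff set_nn_integral_sym_rearr)
qed

lemma finite_measure_sym_meas: "finite_measure (sym_meas f c)"
proof (rule finite_measureI)
  have "(\<integral>\<^sup>+x\<in>{-pi<..<pi}. ennreal (sym_density f x) \<partial>lborel) \<le> (\<integral>\<^sup>+x. ennreal (sym_density f x) \<partial>lborel)"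
    by (intro nn_integral_mono) (auto simp: indicator_def)
  then have "(\<integral>\<^sup>+x\<in>{-pi<..<pi}. ennreal (sym_density f x) \<partial>lborel) < \<infinity>"
    using nn_integral_sym_density_finite by (rule le_less_trans)
  then show "emeasure (sym_meas f c) (space (sym_meas f c)) \<noteq> \<infinity>"
    by (auto simp: space_sym_meas emeasure_sym_meas sets_borel_I_iff indicator_def)
qed

lemma sym_density_minus: "sym_density f (- x) = sym_density f x"
  by (simp add: sym_density_def sym_rearr_def)

lemma measurable_uminus_sym_meas [measurable]: "uminus \<in> measurable (sym_meas f c) (sym_meas f c)"
proof (rule measurableI)
  fix B assume "B \<in> sets (sym_meas f c)"
  then have B: "B \<in> sets borel" "B \<subseteq> {-pi<..<pi}" by (auto simp: sets_sym_meas sets_borel_I_iff)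
  have "uminus -` B \<in> sets borel" using B(1) measurable_sets[of uminus borel borel B] by simp
  moreover have "uminus -` B \<subseteq> {-pi<..<pi}" using B(2) by force
  ultimately show "uminus -` B \<inter> space (sym_meas f c) \<in> sets (sym_meas f c)"
    by (simp add: sets_sym_meas sets_borel_I_iff space_sym_meas)
qed (auto simp: space_sym_meas)

text \<open>The density is even, Lebesgue measure is invariant under reflection, and the atom sits
  at the fixed point 0.\<close>

lemma distr_uminus_sym_meas: "distr (sym_meas f c) (sym_meas f c) uminus = sym_meas f c"
proof (rule measure_eqI)
  fix A assume "A \<in> sets (distr (sym_meas f c) (sym_meas f c) uminus)"
  then have A: "A \<in> sets borel_I" by (simp add: sets_sym_meas)
  then have [measurable]: "A \<in> sets borel" by (simp add: sets_borel_I_iff)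
  have mA: "uminus -` A \<in> sets borel_I"
  proof -
    have "uminus -` A \<in> sets borel" using measurable_sets[of uminus borel borel A] by simp
    moreover have "uminus -` A \<subseteq> {-pi<..<pi}" using A by (force simp: sets_borel_I_iff)
    ultimately show ?thesis by (simp add: sets_borel_I_iff)
  qed
  have "uminus -` A \<inter> space (sym_meas f c) = uminus -` A"
    using mA by (auto simp: space_sym_meas sets_borel_I_iff)
  then have "emeasure (distr (sym_meas f c) (sym_meas f c) uminus) A = emeasure (sym_meas f c) (uminus -` A)"
    using A by (simp add: emeasure_distr sets_sym_meas)
  also have "\<dots> = (\<integral>\<^sup>+x. ennreal (sym_density f x) * indicator A (- x) \<partial>lborel) + ennreal c * indicator A 0"
    using mA by (simp add: emeasure_sym_meas indicator_def)
  also have "(\<integral>\<^sup>+x. ennreal (sym_density f x) * indicator A (- x) \<partial>lborel) 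
      = (\<integral>\<^sup>+x\<in>A. ennreal (sym_density f x) \<partial>lborel)"
    using nn_integral_real_affine[of "\<lambda>x. ennreal (sym_density f x) * indicator A x" "-1" 0]
    by (simp add: sym_density_minus)
  finally show "emeasure (distr (sym_meas f c) (sym_meas f c) uminus) A = emeasure (sym_meas f c) A"
    using A by (simp add: emeasure_sym_meas)
qed simp

end

subsection \<open>Potentials\<close>

lemma green_below: "y \<le> x \<Longrightarrow> green x y = (pi + y) * (pi - x) / (2 * pi)"
  by (simp add: green_def field_simps)

lemma green_above: "x \<le> y \<Longrightarrow> green x y = (pi - y) * (pi + x) / (2 * pi)"
  by (simp add: green_def field_simps)

lemma green_minus_minus: "green (- x) (- y) = green x y"
  by (simp add: green_def abs_minus_commute)

lemma green_pi: "\<bar>y\<bar> \<le> pi \<Longrightarrow> green pi y = 0"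
  by (subst green_below) auto

lemma green_minus_pi: "\<bar>y\<bar> \<le> pi \<Longrightarrow> green (- pi) y = 0"
  by (subst green_above) auto

lemma green_nonneg: "\<bar>x\<bar> \<le> pi \<Longrightarrow> \<bar>y\<bar> \<le> pi \<Longrightarrow> 0 \<le> green x y"
  by (cases "y \<le> x") (auto simp: green_below green_above)

text \<open>The linear term contributes slope at most 1/2 because
  \<open>\<bar>y\<bar> \<le> pi\<close>, the absolute value another 1/2.\<close>

lemma green_lipschitz:
  assumes "\<bar>y\<bar> \<le> pi" shows "\<bar>green x y - green x' y\<bar> \<le> \<bar>x - x'\<bar>"
proof -
  have "green x y - green x' y = - ((x - x') * (y / (2 * pi))) - (\<bar>x - y\<bar> - \<bar>x' - y\<bar>) / 2"
    by (simp add: green_def field_simps)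
  moreover have "\<bar>(x - x') * (y / (2 * pi))\<bar> \<le> \<bar>x - x'\<bar> * (1 / 2)"
    unfolding abs_mult using assms by (intro mult_left_mono) (auto simp: field_simps)
  moreover have "\<bar>\<bar>x - y\<bar> - \<bar>x' - y\<bar>\<bar> \<le> \<bar>x - x'\<bar>" by linarith
  moreover have "\<bar>A\<bar> \<le> e * (1 / 2) \<Longrightarrow> \<bar>B\<bar> \<le> e \<Longrightarrow> \<bar>- A - B / 2\<bar> \<le> e" for A B e :: real by linarith
  ultimately show ?thesis by metis
qed

lemma green_bound: assumes "\<bar>y\<bar> \<le> pi" shows "\<bar>green x y\<bar> \<le> \<bar>x - pi\<bar>"
  using green_lipschitz[OF assms, of x pi] green_pi[OF assms] by simp

text \<open>In its first argument \<open>green\<close> is an affine function minus half an absolute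
  value.\<close>

lemma green_concave:
  assumes "0 \<le> t" "t \<le> 1"
  shows "(1 - t) * green a y + t * green b y \<le> green ((1 - t) * a + t * b) y"
proof -
  have "\<bar>(1 - t) * (a - y) + t * (b - y)\<bar> \<le> (1 - t) * \<bar>a - y\<bar> + t * \<bar>b - y\<bar>"
    using assms by (intro order_trans[OF abs_triangle_ineq]) (simp add: abs_mult)
  moreover have "(1 - t) * (a - y) + t * (b - y) = (1 - t) * a + t * b - y" by (simp add: algebra_simps)
  ultimately have "\<bar>(1 - t) * a + t * b - y\<bar> \<le> (1 - t) * \<bar>a - y\<bar> + t * \<bar>b - y\<bar>" by simp
  moreover have "green ((1 - t) * a + t * b) y - ((1 - t) * green a y + t * green b y)
      = ((1 - t) * \<bar>a - y\<bar> + t * \<bar>b - y\<bar> - \<bar>(1 - t) * a + t * b - y\<bar>) / 2"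
    by (simp add: green_def field_simps)
  ultimately show ?thesis by simp
qed

text \<open>For positive \<open>P\<close>, \<open>Q\<close> with \<open>P + Q \<le> 2 * pi\<close>,
  the trapezoid of height 1 on the interval whose left flank has width \<open>P\<close> and whose
  right flank has width \<open>Q\<close>.\<close>

definition plateau :: "real \<Rightarrow> real \<Rightarrow> real \<Rightarrow> real" where
  "plateau P Q y = min 1 (min ((pi + y) / P) ((pi - y) / Q))"

lemma plateau_measurable [measurable]: "plateau P Q \<in> borel_measurable borel"
  unfolding plateau_def by measurable

lemma plateau_nonneg: "0 < P \<Longrightarrow> 0 < Q \<Longrightarrow> \<bar>y\<bar> \<le> pi \<Longrightarrow> 0 \<le> plateau P Q y"
  by (auto simp: plateau_def)

lemma plateau_pos: "0 < P \<Longrightarrow> 0 < Q \<Longrightarrow> \<bar>y\<bar> < pi \<Longrightarrow> 0 < plateau P Q y"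
  by (auto simp: plateau_def)

text \<open>Where nonempty, the interval has length \<open>2 * pi - t * (P + Q)\<close>. It depends
  only on \<open>P + Q\<close>, so replacing both widths by their mean centres the superlevel sets
  without changing their lengths.\<close>

lemma plateau_superlevel:
  assumes "0 < P" "0 < Q" "0 \<le> t"
  shows "{y \<in> {-pi<..<pi}. t < plateau P Q y} = (if t < 1 then {t * P - pi<..<pi - t * Q} else {})"
proof -
  have "P * t \<ge> 0" "Q * t \<ge> 0" using assms by auto
  then have "P * t < x + pi \<Longrightarrow> - pi < x" "x + Q * t < pi \<Longrightarrow> x < pi" for x by linarith+
  then show ?thesis using assms by (auto simp: plateau_def field_simps)
qed

text \<open>The weights make the combination of the two hats constant between their peaks.\<close>

lemma green_combination:
  assumes "-pi < a" "a \<le> b" "b < pi" "\<bar>y\<bar> \<le> pi"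
  shows "(pi - b) * green a y + (pi + a) * green b y 
    = (pi + a) * (pi - b) * plateau (pi + a) (pi - b) y"
proof -
  consider "y \<le> a" | "a \<le> y" "y \<le> b" | "b \<le> y" by linarith
  then show ?thesis
  proof cases
    case 1
    have "(pi + y) / (pi + a) \<le> 1" "1 \<le> (pi - y) / (pi - b)" using 1 assms by (simp_all add: divide_simps)
    then have "plateau (pi + a) (pi - b) y = (pi + y) / (pi + a)" by (auto simp: plateau_def)
    then have "(pi + a) * (pi - b) * plateau (pi + a) (pi - b) y = (pi - b) * (pi + y)" using assms by simp
    also have "\<dots> = (pi - b) * green a y + (pi + a) * green b y"
      using 1 assms by (simp add: green_below field_simps)
    finally show ?thesis by simp
  next
    case 2
    have "1 \<le> (pi + y) / (pi + a)" "1 \<le> (pi - y) / (pi - b)" using 2 assms by (simp_all add: divide_simps)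
    then have "plateau (pi + a) (pi - b) y = 1" by (auto simp: plateau_def)
    then show ?thesis using 2 assms by (simp add: green_below green_above field_simps)
  next
    case 3
    have "1 \<le> (pi + y) / (pi + a)" "(pi - y) / (pi - b) \<le> 1" using 3 assms by (simp_all add: divide_simps)
    then have "plateau (pi + a) (pi - b) y = (pi - y) / (pi - b)" by (auto simp: plateau_def)
    then have "(pi + a) * (pi - b) * plateau (pi + a) (pi - b) y = (pi + a) * (pi - y)" using assms by simp
    also have "\<dots> = (pi - b) * green a y + (pi + a) * green b y"
      using 3 assms by (simp add: green_above field_simps)
    finally show ?thesis by simp
  qed
qed

section \<open>Potentials of finite measures on the interval\<close>

lemma borel_measurable_borel_I:
  assumes "sets M = sets borel_I" "g \<in> borel_measurable borel"
  shows "g \<in> borel_measurable M"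
proof -
  have "g \<in> borel_measurable borel_I"
    unfolding borel_I_def using assms(2) by (rule measurable_restrict_space1)
  then show ?thesis using measurable_cong_sets[OF assms(1) refl] by blast
qed

locale finite_measure_I = finite_measure M for M :: "real measure" +
  assumes sets_M: "sets M = sets borel_I"
begin

lemma space_M: "space M = {-pi<..<pi}"
  using sets_eq_imp_space_eq[OF sets_M] by (simp add: space_borel_I)

lemma integrable_bounded:
  fixes g :: "real \<Rightarrow> real"
  assumes "g \<in> borel_measurable borel" "\<And>y. \<bar>y\<bar> < pi \<Longrightarrow> \<bar>g y\<bar> \<le> B"
  shows "integrable M g"
proof (rule integrable_const_bound)
  show "AE x in M. norm (g x) \<le> B"
    by (rule AE_I2) (auto simp: space_M abs_less_iff intro!: assms(2))
qed (rule borel_measurable_borel_I[OF sets_M assms(1)])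

lemma integrable_green: "integrable M (green x)"
proof (rule integrable_bounded)
  show "green x \<in> borel_measurable borel" unfolding green_def by measurable
qed (auto intro!: green_bound)

lemma integrable_plateau: "0 < P \<Longrightarrow> 0 < Q \<Longrightarrow> integrable M (plateau P Q)"
  by (rule integrable_bounded[where B=1]) (auto simp: plateau_def min_def)

lemma u_meas_lipschitz: "\<bar>u_meas M x - u_meas M x'\<bar> \<le> \<bar>x - x'\<bar> * measure M (space M)"
proof -
  have "\<bar>u_meas M x - u_meas M x'\<bar> = \<bar>\<integral>y. green x y - green x' y \<partial>M\<bar>"
    by (simp add: u_meas_def integrable_green)
  also have "\<dots> \<le> (\<integral>y. \<bar>green x y - green x' y\<bar> \<partial>M)" by (rule integral_abs_bound)
  also have "\<dots> \<le> (\<integral>y. \<bar>x - x'\<bar> \<partial>M)"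
    by (rule integral_mono) (auto simp: space_M integrable_green intro!: green_lipschitz)
  finally show ?thesis by (simp add: mult.commute)
qed

lemma continuous_on_u_meas: "continuous_on A (u_meas M)"
proof -
  have "(measure M (space M))-lipschitz_on A (u_meas M)"
    using u_meas_lipschitz by (auto simp: lipschitz_on_def dist_real_def mult.commute)
  then show ?thesis by (rule lipschitz_on_continuous_on)
qed

lemma u_meas_pi: "u_meas M pi = 0" "u_meas M (- pi) = 0"
  unfolding u_meas_def
  by (auto simp: space_M green_pi green_minus_pi intro!: integral_eq_zero_AE AE_I2)

lemma u_meas_nonneg: "\<bar>x\<bar> \<le> pi \<Longrightarrow> 0 \<le> u_meas M x"
  unfolding u_meas_def by (rule integral_nonneg_AE, rule AE_I2) (auto simp: space_M intro!: green_nonneg)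

text \<open>The potential is concave, being an integral of concave functions; the bound by the
  minimum is the form used below.\<close>

lemma u_meas_quasiconcave:
  assumes "a \<le> z" "z \<le> b"
  shows "min (u_meas M a) (u_meas M b) \<le> u_meas M z"
proof (cases "a = b")
  case False
  define t where "t = (z - a) / (b - a)"
  have t: "0 \<le> t" "t \<le> 1" using assms False by (auto simp: t_def divide_simps)
  have "t * (b - a) = z - a" using False by (simp add: t_def)
  then have z: "z = (1 - t) * a + t * b" by (simp add: algebra_simps)
  have "(1 - t) * u_meas M a + t * u_meas M b = (\<integral>y. (1 - t) * green a y + t * green b y \<partial>M)"
    by (simp add: u_meas_def integrable_green)
  also have "\<dots> \<le> u_meas M z" unfolding u_meas_def z
    by (rule integral_mono) (auto simp: integrable_green intro!: green_concave[OF t])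
  finally have "(1 - t) * u_meas M a + t * u_meas M b \<le> u_meas M z" .
  moreover have "min (u_meas M a) (u_meas M b) = 
      (1 - t) * min (u_meas M a) (u_meas M b) + t * min (u_meas M a) (u_meas M b)"
    by (simp add: algebra_simps)
  moreover have "\<dots> \<le> (1 - t) * u_meas M a + t * u_meas M b"
    using t by (intro add_mono mult_left_mono) auto
  ultimately show ?thesis by linarith
qed (use assms in auto)

text \<open>Integrating \<open>green_combination\<close> turns two values of the potential into one
  integral of a function whose superlevel sets are intervals.\<close>

lemma u_meas_combination:
  assumes "-pi < a" "a \<le> b" "b < pi"
  shows "(pi - b) * u_meas M a + (pi + a) * u_meas M b
    = (pi + a) * (pi - b) * (\<integral>y. plateau (pi + a) (pi - b) y \<partial>M)"
proof -
  have "(pi - b) * u_meas M a + (pi + a) * u_meas M b = (\<integral>y. (pi - b) * green a y + (pi + a) * green b y \<partial>M)"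
    by (simp add: u_meas_def integrable_green)
  also have "\<dots> = (\<integral>y. (pi + a) * (pi - b) * plateau (pi + a) (pi - b) y \<partial>M)"
    using green_combination[OF assms] by (intro Bochner_Integration.integral_cong) (auto simp: space_M)
  finally show ?thesis by simp
qed

end

text \<open>The measure is recovered from second differences of its potential: trapezoids
  increasing to the indicator of an interval are combinations of four hats.\<close>

lemma green_trapezoid:
  assumes "0 < n"
  shows "real n * (green (a + 1 / n) y - green a y + green (b - 1 / n) y - green b y)
    = real n / 2 * (\<bar>y - a\<bar> - \<bar>y - a - 1 / n\<bar> - \<bar>y - b + 1 / n\<bar> + \<bar>y - b\<bar>)"
proof -
  have *: "\<bar>a + 1 / n - y\<bar> = \<bar>y - a - 1 / n\<bar>" "\<bar>a - y\<bar> = \<bar>y - a\<bar>" "\<bar>b - 1 / n - y\<bar> = \<bar>y - b + 1 / n\<bar>"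
    "\<bar>b - y\<bar> = \<bar>y - b\<bar>" by linarith+
  show ?thesis unfolding green_def * using assms by (simp add: field_simps)
qed

text \<open>The sequence is eventually constant: for \<open>y\<close> inside, once
  \<open>1 / real (Suc n)\<close> is below the distance to both ends; for \<open>y\<close> outside,
  ends included, once it is below \<open>b - a\<close>.\<close>

lemma green_trapezoid_tendsto:
  assumes "a < b"
  shows "(\<lambda>n. real (Suc n) * (green (a + 1 / real (Suc n)) y - green a y + green (b - 1 / real (Suc n)) y - green b y))
     \<longlonglongrightarrow> indicator {a<..<b} y"
proof -
  have ev: "\<forall>\<^sub>F n in sequentially. 1 / real (Suc n) < e" if "0 < e" for e
    using order_tendstoD(2)[OF LIMSEQ_Suc[OF lim_1_over_n] that] by simp
  have "\<forall>\<^sub>F n in sequentially. real (Suc n) / 2 * (\<bar>y - a\<bar> - \<bar>y - a - 1 / real (Suc n)\<bar> 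
      - \<bar>y - b + 1 / real (Suc n)\<bar> + \<bar>y - b\<bar>) = indicator {a<..<b} y"
  proof (cases "y \<in> {a<..<b}")
    case True
    then have "0 < min (y - a) (b - y)" by auto
    from ev[OF this] show ?thesis
    proof eventually_elim
      case (elim n)
      then have "\<bar>y - a\<bar> - \<bar>y - a - 1 / real (Suc n)\<bar> - \<bar>y - b + 1 / real (Suc n)\<bar> + \<bar>y - b\<bar> = 2 * (1 / real (Suc n))"
        using True by (auto simp: abs_if)
      then show ?case using True by simp
    qed
  next
    case False
    have "0 < b - a" using assms by simp
    from ev[OF this] show ?thesis
    proof eventually_elim
      case (elim n)
      moreover have "0 < 1 / real (Suc n)" by simp
      ultimately have "\<bar>y - a\<bar> - \<bar>y - a - 1 / real (Suc n)\<bar> - \<bar>y - b + 1 / real (Suc n)\<bar> + \<bar>y - b\<bar> = 0"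
        using False unfolding greaterThanLessThan_iff by (smt (verit))
      then show ?case using False by simp
    qed
  qed
  then show ?thesis
    unfolding green_trapezoid[OF zero_less_Suc] by (rule tendsto_eventually)
qed

text \<open>The absolute values form two pairs, each with difference at most
  \<open>1 / real (Suc n)\<close>. This supplies the dominating constant for the limit.\<close>

lemma green_trapezoid_bound:
  "\<bar>real (Suc n) * (green (a + 1 / real (Suc n)) y - green a y + green (b - 1 / real (Suc n)) y - green b y)\<bar> \<le> 1"
proof -
  have "\<bar>\<bar>y - a\<bar> - \<bar>y - a - 1 / real (Suc n)\<bar> - \<bar>y - b + 1 / real (Suc n)\<bar> + \<bar>y - b\<bar>\<bar> \<le> 2 * \<bar>1 / real (Suc n)\<bar>"
    by linarith
  then have "real (Suc n) / 2 * \<bar>\<bar>y - a\<bar> - \<bar>y - a - 1 / real (Suc n)\<bar> - \<bar>y - b + 1 / real (Suc n)\<bar> + \<bar>y - b\<bar>\<bar> 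
     \<le> real (Suc n) / 2 * (2 * \<bar>1 / real (Suc n)\<bar>)"
    by (intro mult_left_mono) auto
  also have "\<dots> = 1" by simp
  finally show ?thesis unfolding green_trapezoid[OF zero_less_Suc] abs_mult by simp
qed

lemma (in finite_measure_I) measure_interval_lim_u_meas:
  assumes "a < b" "-pi \<le> a" "b \<le> pi"
  shows "(\<lambda>n. real (Suc n) * (u_meas M (a + 1 / real (Suc n)) - u_meas M a + u_meas M (b - 1 / real (Suc n)) - u_meas M b))
     \<longlonglongrightarrow> measure M {a<..<b}"
proof -
  let ?T = "\<lambda>n y. real (Suc n) * (green (a + 1 / real (Suc n)) y - green a y + green (b - 1 / real (Suc n)) y - green b y)"
  have "(\<lambda>n. \<integral>y. ?T n y \<partial>M) \<longlonglongrightarrow> (\<integral>y. indicator {a<..<b} y \<partial>M)"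
  proof (rule integral_dominated_convergence[where w="\<lambda>_. 1"])
    show "indicat_real {a<..<b} \<in> borel_measurable M"
      by (rule borel_measurable_borel_I[OF sets_M]) auto
    show "AE y in M. (\<lambda>n. ?T n y) \<longlonglongrightarrow> indicator {a<..<b} y"
      using green_trapezoid_tendsto[OF assms(1)] by blast
    show "AE y in M. norm (?T n y) \<le> 1" for n
      using green_trapezoid_bound by (intro AE_I2) simp
    show "?T n \<in> borel_measurable M" for n
      by (intro borel_measurable_integrable) (simp add: integrable_green)
  qed simp
  moreover have "{a<..<b} \<inter> space M = {a<..<b}" using assms by (auto simp: space_M)
  moreover have "(\<integral>y. ?T n y \<partial>M) = real (Suc n) * (u_meas M (a + 1 / real (Suc n)) - u_meas M a + u_meas M (b - 1 / real (Suc n)) - u_meas M b)" for n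
    by (simp add: u_meas_def integrable_green)
  ultimately show ?thesis by simp
qed

text \<open>Equal potentials have equal second differences, hence the measures agree on open
  subintervals, and these determine a finite measure.\<close>

lemma u_meas_determines_measure:
  assumes "finite_measure_I M" "finite_measure_I M'"
    and eq: "\<And>x. \<bar>x\<bar> \<le> pi \<Longrightarrow> u_meas M x = u_meas M' x"
  shows "M = M'"
proof -
  interpret M: finite_measure_I M by fact
  interpret M': finite_measure_I M' by fact
  have int: "emeasure M {a<..<b} = emeasure M' {a<..<b}" if ab: "-pi \<le> a" "b \<le> pi" for a b
  proof (cases "a < b")
    case True
    have "(\<lambda>n. 1 / real (Suc n)) \<longlonglongrightarrow> 0" using LIMSEQ_Suc[OF lim_1_over_n] by simp
    \<comment> \<open>This keeps both shifted points between \<open>a\<close> and \<open>b\<close>,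
      where the potentials are known to agree.\<close>
    then have "\<forall>\<^sub>F n in sequentially. 1 / real (Suc n) < b - a"
      using True by (intro order_tendstoD(2)) auto
    then have "\<forall>\<^sub>F n in sequentially. real (Suc n) * (u_meas M (a + 1 / real (Suc n)) - u_meas M a + u_meas M (b - 1 / real (Suc n)) - u_meas M b) = real (Suc n) * (u_meas M' (a + 1 / real (Suc n)) - u_meas M' a + u_meas M' (b - 1 / real (Suc n)) - u_meas M' b)"
    proof eventually_elim
      case (elim n)
      moreover have "0 < 1 / real (Suc n)" by simp
      ultimately have "\<bar>a + 1 / real (Suc n)\<bar> \<le> pi" "\<bar>b - 1 / real (Suc n)\<bar> \<le> pi" "\<bar>a\<bar> \<le> pi" "\<bar>b\<bar> \<le> pi"
        using ab True unfolding abs_le_iff by linarith+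
      then show ?case by (simp add: eq)
    qed
    from Lim_transform_eventually[OF M.measure_interval_lim_u_meas[OF True ab] this]
    have "measure M {a<..<b} = measure M' {a<..<b}"
      by (rule LIMSEQ_unique[OF _ M'.measure_interval_lim_u_meas[OF True ab]])
    then show ?thesis by (simp add: M.emeasure_eq_measure M'.emeasure_eq_measure)
  qed simp
  have sets_eq: "sets M = sets M'" by (simp add: M.sets_M M'.sets_M)
  have id: "id \<in> measurable L borel" if "sets L = sets borel_I" for L
    by (rule borel_measurable_borel_I[OF that]) simp
  \<comment> \<open>Uniqueness from half-lines is a statement about measures on the whole line, so
    both measures are pushed forward along the inclusion.\<close>
  have dist: "distr M borel id = distr M' borel id"
  proof (rule measure_eqI_lessThan)
    fix x :: real
    have e: "emeasure (distr L borel id) {x<..} = emeasure L {max x (-pi)<..<pi}" if "finite_measure_I L" for L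
    proof -
      interpret L: finite_measure_I L by fact
      have "id -` {x<..} \<inter> space L = {max x (-pi)<..<pi}" by (auto simp: L.space_M)
      then show ?thesis by (simp add: emeasure_distr id[OF L.sets_M])
    qed
    show "emeasure (distr M borel id) {x<..} = emeasure (distr M' borel id) {x<..}"
      using int[of "max x (-pi)" pi] by (simp add: e assms)
    show "emeasure (distr M borel id) {x<..} < \<infinity>" 
      by (simp add: e assms M.emeasure_eq_measure)
  qed auto
  show ?thesis
  proof (rule measure_eqI)
    fix A assume A: "A \<in> sets M"
    then have A': "A \<in> sets borel" "A \<subseteq> {-pi<..<pi}" by (auto simp: M.sets_M sets_borel_I_iff)
    have "emeasure L A = emeasure (distr L borel id) A" if "finite_measure_I L" for L
    proof -
      interpret L: finite_measure_I L by fact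
      have "id -` A \<inter> space L = A" using A' by (auto simp: L.space_M)
      then show ?thesis using A' by (simp add: emeasure_distr id[OF L.sets_M])
    qed
    then show "emeasure M A = emeasure M' A" by (simp add: assms dist)
  qed (rule sets_eq)
qed

subsection \<open>Integral comparison from level sets\<close>

text \<open>The superlevel set of \<open>p\<close> lies in its hull. Two of its points near the ends
  of the hull form a chord, and \<open>q\<close> exceeds \<open>t\<close> at half the length of that
  chord.\<close>

lemma superlevel_measure_le:
  fixes p q :: "real \<Rightarrow> real"
  assumes [measurable]: "p \<in> borel_measurable borel" "q \<in> borel_measurable borel"
    and anti: "\<And>x y. 0 \<le> x \<Longrightarrow> x \<le> y \<Longrightarrow> y \<le> pi \<Longrightarrow> q y \<le> q x"
    and le: "\<And>a b. -pi \<le> a \<Longrightarrow> a \<le> b \<Longrightarrow> b \<le> pi \<Longrightarrow> min (p a) (p b) \<le> q ((b - a) / 2)"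
  shows "emeasure lborel {x \<in> {-pi..pi}. t < p x} \<le> emeasure lborel {x \<in> {-pi..pi}. t < q \<bar>x\<bar>}"
proof (cases "{x \<in> {-pi..pi}. t < p x} = {}")
  case False
  define S where "S = {x \<in> {-pi..pi}. t < p x}"
  have ne: "S \<noteq> {}" using False by (simp add: S_def)
  have bdd: "bdd_below S" "bdd_above S" by (auto simp: S_def bdd_below_def bdd_above_def)
  have "S \<subseteq> {Inf S..Sup S}" using cInf_lower[OF _ bdd(1)] cSup_upper[OF _ bdd(2)] by auto
  then have "emeasure lborel S \<le> emeasure lborel {Inf S..Sup S}" by (intro emeasure_mono) auto
  also have "\<dots> = ennreal (Sup S - Inf S)"
    by (simp add: cInf_le_cSup bdd ne)
  also have "\<dots> \<le> emeasure lborel {x \<in> {-pi..pi}. t < q \<bar>x\<bar>}"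
  \<comment> \<open>The infimum and supremum of \<open>S\<close> need not belong to
    \<open>S\<close>, hence the error \<open>e\<close>.\<close>
  proof (rule ennreal_le_epsilon)
    fix e :: real assume e: "0 < e"
    obtain a where a: "a \<in> S" "a < Inf S + e / 2" using cInf_lessD[OF ne, of "Inf S + e / 2"] e by auto
    obtain b where b: "b \<in> S" "b > Sup S - e / 2" using less_cSupD[OF ne, of "Sup S - e / 2"] e by auto
    \<comment> \<open>If \<open>S\<close> is short, the points chosen near its ends may come in the
      wrong order.\<close>
    define c d where "c = min a b" and "d = max a b"
    have cd: "c \<in> S" "d \<in> S" "c \<le> d" "Sup S - Inf S \<le> d - c + e"
      using a b unfolding c_def d_def by (auto simp: min_def max_def)
    define r where "r = (d - c) / 2"
    have r: "0 \<le> r" "r \<le> pi" using cd by (auto simp: r_def S_def)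
    have "t < q r" using le[of c d] cd by (auto simp: S_def r_def)
    then have "{-r..r} \<subseteq> {x \<in> {-pi..pi}. t < q \<bar>x\<bar>}"
      using r anti[of _ r] by (fastforce simp: abs_le_iff intro: less_le_trans)
    then have "emeasure lborel {-r..r} \<le> emeasure lborel {x \<in> {-pi..pi}. t < q \<bar>x\<bar>}"
      by (intro emeasure_mono) auto
    moreover have "emeasure lborel {-r..r} = ennreal (d - c)"
      using emeasure_lborel_Icc[of "-r" r] r(1) by (simp add: r_def field_simps)
    ultimately have "ennreal (d - c) + ennreal e \<le> emeasure lborel {x \<in> {-pi..pi}. t < q \<bar>x\<bar>} + ennreal e"
      by (simp only: add_right_mono)
    moreover have "ennreal (Sup S - Inf S) \<le> ennreal (d - c) + ennreal e"
      using cd e by (simp flip: ennreal_plus add: ennreal_leI)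
    ultimately show "ennreal (Sup S - Inf S) \<le> emeasure lborel {x \<in> {-pi..pi}. t < q \<bar>x\<bar>} + ennreal e"
      by (rule order_trans[rotated])
  qed
  finally show ?thesis by (simp add: S_def)
qed (simp only: emeasure_empty zero_le)

lemma set_integrable_bounded:
  fixes p :: "real \<Rightarrow> real"
  assumes [measurable]: "p \<in> borel_measurable borel" and "\<And>x. \<bar>x\<bar> \<le> pi \<Longrightarrow> \<bar>p x\<bar> \<le> B"
  shows "set_integrable lborel {-pi..pi} p"
  unfolding set_integrable_def
proof (rule Bochner_Integration.integrable_bound)
  show "integrable lborel (\<lambda>x. indicator {-pi..pi} x *\<^sub>R B)" by simp
  show "AE x in lborel. norm (indicator {-pi..pi} x *\<^sub>R p x) \<le> norm (indicator {-pi..pi} x *\<^sub>R B)"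
    using assms(2) by (intro AE_I2) (auto simp: indicator_def abs_le_iff intro: order_trans[OF _ abs_ge_self])
qed measurable

text \<open>The hypothesis says that every superlevel set of \<open>q \<circ> abs\<close> is at least as long as
  the convex hull of the corresponding superlevel set of \<open>p\<close>.\<close>

lemma set_integral_le_of_min_le:
  fixes p q :: "real \<Rightarrow> real"
  assumes [measurable]: "p \<in> borel_measurable borel" "q \<in> borel_measurable borel"
    and bp: "\<And>x. \<bar>x\<bar> \<le> pi \<Longrightarrow> \<bar>p x\<bar> \<le> B"
    and bq: "\<And>x. \<bar>x\<bar> \<le> pi \<Longrightarrow> \<bar>q x\<bar> \<le> B"
    and anti: "\<And>x y. 0 \<le> x \<Longrightarrow> x \<le> y \<Longrightarrow> y \<le> pi \<Longrightarrow> q y \<le> q x"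
    and le: "\<And>a b. -pi \<le> a \<Longrightarrow> a \<le> b \<Longrightarrow> b \<le> pi \<Longrightarrow> min (p a) (p b) \<le> q ((b - a) / 2)"
  shows "(LINT x:{-pi..pi}|lborel. p x) \<le> (LINT x:{-pi..pi}|lborel. q \<bar>x\<bar>)"
proof -
  have int: "set_integrable lborel {-pi..pi} p" "set_integrable lborel {-pi..pi} (\<lambda>x. q \<bar>x\<bar>)"
    "set_integrable lborel {-pi..pi} (\<lambda>x. B)"
    using bp bq by (auto intro!: set_integrable_bounded[where B="\<bar>B\<bar>"] intro: order_trans[OF _ abs_ge_self])
  \<comment> \<open>Adding the bound \<open>B\<close> makes both functions nonnegative, so that
    their integrals can be compared through superlevel sets.\<close>
  let ?P = "\<lambda>x. indicator {-pi..pi} x *\<^sub>R (p x + B)" and ?Q = "\<lambda>x. indicator {-pi..pi} x *\<^sub>R (q \<bar>x\<bar> + B)"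
  have intPQ: "integrable lborel ?P" "integrable lborel ?Q"
    using set_integral_add(1)[OF int(1) int(3)] set_integral_add(1)[OF int(2) int(3)]
    by (simp_all add: set_integrable_def)
  have nonneg: "0 \<le> ?P x" "0 \<le> ?Q x" for x
    using bp[of x] bq[of "\<bar>x\<bar>"] by (auto simp: indicator_def abs_le_iff)
  have "(\<integral>\<^sup>+x. ennreal (?P x) \<partial>lborel) \<le> (\<integral>\<^sup>+x. ennreal (?Q x) \<partial>lborel)"
  proof (rule nn_integral_mono_superlevel)
    fix t :: real assume t: "0 \<le> t"
    have "{x \<in> space lborel. t < ?P x} = {x \<in> {-pi..pi}. t - B < p x}"
         "{x \<in> space lborel. t < ?Q x} = {x \<in> {-pi..pi}. t - B < q \<bar>x\<bar>}"
      using t by (auto simp: indicator_def split: if_splits)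
    then show "emeasure lborel {x \<in> space lborel. t < ?P x} \<le> emeasure lborel {x \<in> space lborel. t < ?Q x}"
      using superlevel_measure_le[OF assms(1,2) anti le] by simp
  qed (auto intro: sigma_finite_lborel)
  moreover have "(\<integral>\<^sup>+x. ennreal (?P x) \<partial>lborel) = ennreal (\<integral>x. ?P x \<partial>lborel)"
    by (rule nn_integral_eq_integral[OF intPQ(1)]) (use nonneg in auto)
  moreover have "(\<integral>\<^sup>+x. ennreal (?Q x) \<partial>lborel) = ennreal (\<integral>x. ?Q x \<partial>lborel)"
    by (rule nn_integral_eq_integral[OF intPQ(2)]) (use nonneg in auto)
  moreover have "0 \<le> (\<integral>x. ?Q x \<partial>lborel)" using nonneg(2) by (rule Bochner_Integration.integral_nonneg)
  ultimately have "(LINT x:{-pi..pi}|lborel. p x + B) \<le> (LINT x:{-pi..pi}|lborel. q \<bar>x\<bar> + B)"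
    by (simp add: set_lebesgue_integral_def)
  then show ?thesis
    using set_integral_add(2)[OF int(1) int(3)] set_integral_add(2)[OF int(2) int(3)] by simp
qed

text \<open>A nonnegative difference with nonpositive integral vanishes almost everywhere.\<close>

lemma set_integral_eq_imp_AE_eq:
  fixes p q :: "real \<Rightarrow> real"
  assumes int: "set_integrable lborel {-pi..pi} p" "set_integrable lborel {-pi..pi} q"
    and le: "AE x in lborel. x \<in> {-pi..pi} \<longrightarrow> p x \<le> q x"
    and ge: "(LINT x:{-pi..pi}|lborel. q x) \<le> (LINT x:{-pi..pi}|lborel. p x)"
  shows "AE x in lborel. x \<in> {-pi..pi} \<longrightarrow> p x = q x"
proof -
  let ?d = "\<lambda>x. indicator {-pi..pi} x *\<^sub>R q x - indicator {-pi..pi} x *\<^sub>R p x"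
  have i: "integrable lborel ?d" using int by (auto simp: set_integrable_def)
  have nn: "AE x in lborel. 0 \<le> ?d x" using le by eventually_elim (auto simp: indicator_def)
  have "integral\<^sup>L lborel ?d \<le> 0" using ge int by (simp add: set_integrable_def set_lebesgue_integral_def)
  moreover have "0 \<le> integral\<^sup>L lborel ?d" using nn by (rule integral_nonneg_AE)
  ultimately have "integral\<^sup>L lborel ?d = 0" by simp
  then have "AE x in lborel. ?d x = 0" using integral_nonneg_eq_0_iff_AE[OF i nn] by simp
  then show ?thesis by eventually_elim auto
qed

text \<open>The set where two continuous functions differ is open; if nonempty inside
  \<open>{a<..<b}\<close>, it would contain an interval of positive length.\<close>

lemma continuous_AE_eq_imp_eq:
  fixes u v :: "real \<Rightarrow> real"
  assumes cont: "continuous_on UNIV u" "continuous_on UNIV v"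
    and ae: "AE x in lborel. x \<in> {a..b} \<longrightarrow> u x = v x" and x: "a < x" "x < b"
  shows "u x = v x"
proof (rule ccontr)
  assume neq: "u x \<noteq> v x"
  have "open {y. u y \<noteq> v y}" using cont by (intro open_Collect_neq)
  then have "open ({y. u y \<noteq> v y} \<inter> {a<..<b})" by auto
  moreover have "x \<in> {y. u y \<noteq> v y} \<inter> {a<..<b}" using x neq by simp
  ultimately obtain e where e: "e > 0" "cball x e \<subseteq> {y. u y \<noteq> v y} \<inter> {a<..<b}"
    using open_contains_cball by blast
  have "AE y in lborel. y \<notin> {x-e..x+e}"
    using ae
  proof eventually_elim
    case (elim y)
    show ?case
    proof
      assume "y \<in> {x-e..x+e}"
      then have "y \<in> cball x e" by (auto simp: dist_real_def)
      with e(2) have "u y \<noteq> v y" "y \<in> {a<..<b}" by auto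
      with elim show False by auto
    qed
  qed
  then have "{x-e..x+e} \<in> null_sets lborel" using AE_iff_null_sets[of "{x-e..x+e}" lborel] by auto
  then show False using e(1) by (auto simp: null_sets_def)
qed

text \<open>\<open>x\<close> is the midpoint of \<open>2 * x - y\<close> and \<open>y\<close>.
  Strict convexity there, together with \<open>\<phi> (2 * x - y) \<le> \<phi> x\<close>, leaves
  \<open>\<phi> x < \<phi> y\<close>.\<close>

lemma strict_convex_mono_imp_strict_mono:
  fixes \<phi> :: "real \<Rightarrow> real"
  assumes sc: "strict_convex_on UNIV \<phi>" and m: "mono \<phi>"
  shows "strict_mono \<phi>"
proof (rule strict_monoI)
  fix x y :: real assume xy: "x < y"
  have "\<phi> ((1 - 1/2) * (2 * x - y) + 1/2 * y) < (1 - 1/2) * \<phi> (2 * x - y) + 1/2 * \<phi> y"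
    using sc xy unfolding strict_convex_on_def
    by (elim conjE, drule_tac x="2 * x - y" in bspec, simp, drule_tac x=y in bspec, simp, 
        drule_tac x="1/2" in spec, simp)
  moreover have "(1 - 1/2) * (2 * x - y) + 1/2 * y = x" by (simp add: field_simps)
  moreover have "\<phi> (2 * x - y) \<le> \<phi> x" using m xy by (auto simp: mono_def)
  ultimately show "\<phi> x < \<phi> y" by simp
qed

subsection \<open>Comparison with the symmetrized measure\<close>

locale decomposed_measure = finite_measure_I M for M :: "real measure" +
  fixes f :: "real \<Rightarrow> real" and N :: "real set"
  assumes decomp: "lebesgue_decomp M f N"
    and nonzero: "emeasure M (space M) \<noteq> 0"
begin

sublocale integrable_density f
  using decomp by unfold_locales (auto simp: lebesgue_decomp_def)

abbreviation "M_sym \<equiv> sym_meas f (measure M N)"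

sublocale sym: finite_measure_I M_sym
  using finite_measure_sym_meas by (simp add: finite_measure_I_def finite_measure_I_axioms_def sets_sym_meas)

lemma N_in_sets: "N \<in> sets M" "N \<in> null_sets lborel"
  using decomp by (auto simp: lebesgue_decomp_def sets_M sets_borel_I_iff null_sets_def)

lemma emeasure_decomp:
  "A \<in> sets M \<Longrightarrow> emeasure M A = (\<integral>\<^sup>+x\<in>A. ennreal (f x) \<partial>lborel) + emeasure M (A \<inter> N)"
  using decomp by (simp add: lebesgue_decomp_def)

text \<open>The density part is handled by rearrangement. The singular part only gains by being
  moved to 0, since every centred open interval of positive length contains 0.\<close>

lemma emeasure_interval_le:
  assumes "-pi \<le> a" "b \<le> pi" "b - a = 2 * s" "0 < s"
  shows "emeasure M {a<..<b} \<le> emeasure M_sym {-s<..<s}"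
proof -
  have s: "s \<le> pi" using assms by simp
  have "emeasure M {a<..<b} = (\<integral>\<^sup>+x\<in>{a<..<b}. ennreal (f x) \<partial>lborel) + emeasure M ({a<..<b} \<inter> N)"
    using assms by (intro emeasure_decomp) (auto simp: sets_M sets_borel_I_iff)
  also have "\<dots> \<le> (\<integral>\<^sup>+x\<in>{-s<..<s}. ennreal (sym_density f x) \<partial>lborel) + emeasure M N"
    using assms N_in_sets by (intro add_mono set_nn_integral_interval_le_sym_density emeasure_mono) auto
  also have "\<dots> = emeasure M_sym {-s<..<s}"
    using assms s by (simp add: emeasure_sym_meas sets_borel_I_iff emeasure_eq_measure subset_eq)
  finally show ?thesis .
qed

text \<open>Superlevel sets of the two trapezoids at the same level are intervals of equal length,
  the second one centred, so \<open>emeasure_interval_le\<close> applies at each level.\<close>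

lemma integral_plateau_le:
  assumes "0 < P" "0 < Q" "P + Q \<le> 2 * pi"
  shows "(\<integral>y. plateau P Q y \<partial>M) \<le> (\<integral>y. plateau ((P + Q) / 2) ((P + Q) / 2) y \<partial>M_sym)"
proof -
  define R where "R = (P + Q) / 2"
  have R: "0 < R" "R \<le> pi" using assms by (auto simp: R_def)
  have "(\<integral>\<^sup>+y. ennreal (plateau P Q y) \<partial>M) \<le> (\<integral>\<^sup>+y. ennreal (plateau R R y) \<partial>M_sym)"
  proof (rule nn_integral_mono_superlevel)
    fix t :: real assume t: "0 \<le> t"
    show "emeasure M {x \<in> space M. t < plateau P Q x} \<le> emeasure M_sym {x \<in> space M_sym. t < plateau R R x}"
      unfolding space_M sym.space_M plateau_superlevel[OF assms(1,2) t] plateau_superlevel[OF R(1) R(1) t]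
    proof (cases "t < 1")
      case True
      \<comment> \<open>Below level 1 the centred superlevel interval is nondegenerate.\<close>
      have "t * R < 1 * R" using True R by (intro mult_strict_right_mono) auto
      then have "t * R < pi" using R by linarith
      then have "emeasure M {t * P - pi<..<pi - t * Q} \<le> emeasure M_sym {- (pi - t * R)<..<pi - t * R}"
        using t assms by (intro emeasure_interval_le) (auto simp: R_def field_simps)
      then show "emeasure M (if t < 1 then {t * P - pi<..<pi - t * Q} else {})
          \<le> emeasure M_sym (if t < 1 then {t * R - pi<..<pi - t * R} else {})"
        using True by simp
    qed simp
  qed (auto intro: borel_measurable_borel_I[OF sets_M] borel_measurable_borel_I[OF sym.sets_M] 
      sigma_finite_measure_axioms sym.sigma_finite_measure_axioms)
  moreover have "(\<integral>\<^sup>+y. ennreal (plateau P Q y) \<partial>M) = ennreal (\<integral>y. plateau P Q y \<partial>M)"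
    using assms by (intro nn_integral_eq_integral integrable_plateau AE_I2 plateau_nonneg) (auto simp: space_M)
  moreover have "(\<integral>\<^sup>+y. ennreal (plateau R R y) \<partial>M_sym) = ennreal (\<integral>y. plateau R R y \<partial>M_sym)"
    using R by (intro nn_integral_eq_integral sym.integrable_plateau AE_I2 plateau_nonneg) (auto simp: sym.space_M)
  moreover have "0 \<le> (\<integral>y. plateau R R y \<partial>M_sym)"
    using R by (intro integral_nonneg_AE AE_I2 plateau_nonneg) (auto simp: sym.space_M)
  ultimately show ?thesis by (simp add: R_def)
qed

text \<open>The trapezoid is positive on the whole open interval, and \<open>M_sym\<close> has at
  least the mass of the nonzero measure \<open>M\<close>.\<close>

lemma integral_plateau_sym_pos:
  assumes "0 < R" shows "0 < (\<integral>y. plateau R R y \<partial>M_sym)"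
proof -
  have nn: "AE y in M_sym. 0 \<le> plateau R R y"
    using assms by (intro AE_I2 plateau_nonneg) (auto simp: sym.space_M)
  have "(\<integral>y. plateau R R y \<partial>M_sym) \<noteq> 0"
  proof
    assume "(\<integral>y. plateau R R y \<partial>M_sym) = 0"
    then have "AE y in M_sym. plateau R R y = 0"
      using integral_nonneg_eq_0_iff_AE[OF sym.integrable_plateau nn] assms by simp
    then have "AE y in M_sym. False"
    proof (rule AE_mp, intro AE_I2 impI)
      fix y assume "y \<in> space M_sym" "plateau R R y = 0"
      then show False using plateau_pos[OF assms assms, of y] by (auto simp: sym.space_M abs_less_iff)
    qed
    then have "emeasure M_sym (space M_sym) = 0" by (simp add: AE_iff_measurable[OF _ refl])
    moreover have "emeasure M (space M) \<le> emeasure M_sym (space M_sym)"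
      unfolding space_M sym.space_M by (rule emeasure_interval_le) auto
    ultimately show False using nonzero by simp
  qed
  moreover have "0 \<le> (\<integral>y. plateau R R y \<partial>M_sym)" using nn by (rule integral_nonneg_AE)
  ultimately show ?thesis by simp
qed

lemma u_meas_sym_minus: "u_meas M_sym (- x) = u_meas M_sym x"
proof -
  have "u_meas M_sym (- x) = (\<integral>y. green (- x) y \<partial>distr M_sym M_sym uminus)"
    by (simp add: u_meas_def distr_uminus_sym_meas)
  also have "\<dots> = (\<integral>y. green (- x) (- y) \<partial>M_sym)"
    by (rule integral_distr[OF measurable_uminus_sym_meas]) 
      (rule borel_measurable_integrable[OF sym.integrable_green])
  finally show ?thesis by (simp add: green_minus_minus u_meas_def)
qed

text \<open>The combination formula at \<open>a = - r\<close>, \<open>b = r\<close>, where symmetry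
  makes the two values of the potential equal.\<close>

lemma u_meas_sym_eq_integral_plateau:
  assumes "0 \<le> r" "r < pi"
  shows "2 * u_meas M_sym r = (pi - r) * (\<integral>y. plateau (pi - r) (pi - r) y \<partial>M_sym)"
proof -
  have "(pi - r) * (2 * u_meas M_sym r) = (pi - r) * ((pi - r) * (\<integral>y. plateau (pi - r) (pi - r) y \<partial>M_sym))"
    using sym.u_meas_combination[of "- r" r] assms by (simp add: u_meas_sym_minus mult.assoc)
  then show ?thesis using assms by simp
qed

text \<open>\<open>x\<close> lies between \<open>- y\<close> and \<open>y\<close>, at which the even
  potential takes the same value.\<close>

lemma u_meas_sym_antimono:
  assumes "0 \<le> x" "x \<le> y" shows "u_meas M_sym y \<le> u_meas M_sym x"
  using sym.u_meas_quasiconcave[of "- y" x y] assms by (simp add: u_meas_sym_minus)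

text \<open>The part of Talenti's comparison that precedes AM-GM, shared by the inequality and its
  equality case.\<close>

lemma min_u_meas_le_interior:
  assumes "-pi < a" "a \<le> b" "b < pi"
  defines "R \<equiv> pi - (b - a) / 2"
  shows "2 * R * min (u_meas M a) (u_meas M b) 
    \<le> (pi + a) * (pi - b) * (\<integral>y. plateau R R y \<partial>M_sym)"
proof -
  have R: "R = ((pi + a) + (pi - b)) / 2" by (simp add: R_def field_simps)
  \<comment> \<open>The weights \<open>pi - b\<close> and \<open>pi + a\<close> add up to
    \<open>2 * R\<close>.\<close>
  have "2 * R * min (u_meas M a) (u_meas M b) 
      = (pi - b) * min (u_meas M a) (u_meas M b) + (pi + a) * min (u_meas M a) (u_meas M b)"
    unfolding distrib_right[symmetric] by (simp add: R)
  also have "\<dots> \<le> (pi - b) * u_meas M a + (pi + a) * u_meas M b"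
    using assms by (intro add_mono mult_left_mono) auto
  also have "\<dots> = (pi + a) * (pi - b) * (\<integral>y. plateau (pi + a) (pi - b) y \<partial>M)"
    by (rule u_meas_combination[OF assms(1-3)])
  also have "\<dots> \<le> (pi + a) * (pi - b) * (\<integral>y. plateau R R y \<partial>M_sym)"
    unfolding R using assms by (intro mult_left_mono integral_plateau_le) auto
  finally show ?thesis .
qed

lemma min_u_meas_le:
  assumes "-pi \<le> a" "a \<le> b" "b \<le> pi"
  shows "min (u_meas M a) (u_meas M b) \<le> u_meas M_sym ((b - a) / 2)"
proof (cases "-pi < a \<and> b < pi")
  case True
  define R J where "R = pi - (b - a) / 2" and "J = (\<integral>y. plateau R R y \<partial>M_sym)"
  have R: "0 < R" using True by (simp add: R_def field_simps)
  have J: "0 < J" unfolding J_def by (rule integral_plateau_sym_pos[OF R])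
  have "(pi + a) * (pi - b) \<le> R * R"
  proof -
    \<comment> \<open>AM-GM for \<open>pi + a\<close> and \<open>pi - b\<close>, whose mean is
      \<open>R\<close>, with explicit defect.\<close>
    have "R * R - (pi + a) * (pi - b) = ((a + b) / 2)^2"
      by (simp add: R_def power2_eq_square field_simps)
    then show ?thesis by (smt (verit) zero_le_power2)
  qed
  then have "(pi + a) * (pi - b) * J \<le> R * R * J" using J by (intro mult_right_mono) auto
  moreover have "R * J = 2 * u_meas M_sym ((b - a) / 2)"
    using u_meas_sym_eq_integral_plateau[of "(b - a) / 2"] True assms by (simp add: R_def J_def)
  moreover have "2 * R * min (u_meas M a) (u_meas M b) \<le> (pi + a) * (pi - b) * J"
    unfolding R_def J_def using min_u_meas_le_interior[of a b] True assms by blast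
  ultimately have "2 * R * min (u_meas M a) (u_meas M b) \<le> 2 * R * u_meas M_sym ((b - a) / 2)"
    by (simp add: mult.assoc)
  then show ?thesis using R by simp
next
  case False
  \<comment> \<open>At an end of the interval the potential of \<open>M\<close> vanishes.\<close>
  then have "a = -pi \<or> b = pi" using assms by auto
  then have "min (u_meas M a) (u_meas M b) \<le> 0" by (auto simp: u_meas_pi)
  also have "\<dots> \<le> u_meas M_sym ((b - a) / 2)" using assms by (intro sym.u_meas_nonneg) auto
  finally show ?thesis .
qed

text \<open>Since \<open>J\<close> is positive it can be cancelled, and equality in the comparison
  becomes equality in AM-GM.\<close>

lemma min_u_meas_eq_imp_centred:
  assumes "-pi \<le> a" "a \<le> b" "b \<le> pi"
    and eq: "u_meas M_sym ((b - a) / 2) \<le> min (u_meas M a) (u_meas M b)"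
  shows "a = - b"
\<comment> \<open>\<open>R\<close> vanishes exactly for the full interval, which is centred
  already.\<close>
proof (cases "a = -pi \<and> b = pi")
  case False
  define R J where "R = pi - (b - a) / 2" and "J = (\<integral>y. plateau R R y \<partial>M_sym)"
  have R: "0 < R" using False assms by (auto simp: R_def field_simps)
  have J: "0 < J" unfolding J_def by (rule integral_plateau_sym_pos[OF R])
  have RJ: "R * J = 2 * u_meas M_sym ((b - a) / 2)"
    using u_meas_sym_eq_integral_plateau[of "(b - a) / 2"] R assms by (simp add: R_def J_def)
  then have pos: "0 < min (u_meas M a) (u_meas M b)" using mult_pos_pos[OF R J] eq by linarith
  have "a \<noteq> -pi" "b \<noteq> pi" using pos by (auto simp: u_meas_pi)
  then have ab: "-pi < a" "b < pi" using assms by auto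
  have "2 * R * u_meas M_sym ((b - a) / 2) \<le> 2 * R * min (u_meas M a) (u_meas M b)"
    using eq R by (intro mult_left_mono) auto
  also have "\<dots> \<le> (pi + a) * (pi - b) * J"
    unfolding R_def J_def using min_u_meas_le_interior[of a b] ab assms by blast
  finally have "R * R * J \<le> (pi + a) * (pi - b) * J" using RJ by (simp add: mult.assoc)
  then have "R * R \<le> (pi + a) * (pi - b)" using J by simp
  moreover have "R * R - (pi + a) * (pi - b) = ((a + b) / 2)^2"
    by (simp add: R_def power2_eq_square field_simps)
  ultimately have "((a + b) / 2)^2 \<le> 0" by linarith
  then show ?thesis by simp
qed auto

text \<open>Equal parts give equal measures. Conversely, restricting to the null set
  \<open>N\<close> isolates the singular part; subtracting it leaves the densities, which are unique
  almost everywhere.\<close>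

lemma eq_sym_meas_iff:
  "((AE x in lborel. x \<in> {-pi<..<pi} \<longrightarrow> f x = sym_rearr f x) \<and>
     (\<forall>A \<in> sets M. emeasure M (A \<inter> N) = ennreal (measure M N) * indicator A 0))
   \<longleftrightarrow> M = M_sym" (is "?f \<and> ?s \<longleftrightarrow> _")
proof
  assume *: "?f \<and> ?s"
  show "M = M_sym"
  proof (rule measure_eqI)
    fix A assume A: "A \<in> sets M"
    then have A': "A \<in> sets borel_I" "A \<subseteq> {-pi<..<pi}" by (auto simp: sets_M sets_borel_I_iff)
    have "(\<integral>\<^sup>+x\<in>A. ennreal (f x) \<partial>lborel) = (\<integral>\<^sup>+x\<in>A. ennreal (sym_rearr f x) \<partial>lborel)"
    proof (rule nn_integral_cong_AE)
      show "AE x in lborel. ennreal (f x) * indicator A x = ennreal (sym_rearr f x) * indicator A x"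
        using conjunct1[OF *] by eventually_elim (use A' in \<open>auto simp: indicator_def\<close>)
    qed
    then show "emeasure M A = emeasure M_sym A"
      using emeasure_decomp[OF A] * A A' by (simp add: emeasure_sym_meas set_nn_integral_sym_rearr)
  qed (simp add: sets_M sym.sets_M)
next
  assume eq: "M = M_sym"
  have AN: "emeasure M (A \<inter> N) = ennreal (measure M N) * indicator (A \<inter> N) 0" if "A \<in> sets M" for A
  proof -
    have "A \<inter> N \<in> sets M" using that N_in_sets by auto
    then have "emeasure M_sym (A \<inter> N) 
        = (\<integral>\<^sup>+x\<in>A \<inter> N. ennreal (sym_density f x) \<partial>lborel) + ennreal (measure M N) * indicator (A \<inter> N) 0"
      by (simp add: emeasure_sym_meas sets_M)
    moreover have "(\<integral>\<^sup>+x\<in>A \<inter> N. ennreal (sym_density f x) \<partial>lborel) = 0"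
    proof -
      have "(\<integral>\<^sup>+x\<in>A \<inter> N. ennreal (sym_density f x) \<partial>lborel) = (\<integral>\<^sup>+x. 0 \<partial>(lborel :: real measure))"
        using AE_not_in[OF N_in_sets(2)] by (intro nn_integral_cong_AE, eventually_elim) auto
      then show ?thesis by simp
    qed
    ultimately show ?thesis using eq by simp
  qed
  \<comment> \<open>The case \<open>A = N\<close>. A nonzero singular mass forces
    \<open>0 \<in> N\<close>, so \<open>A\<close> may replace \<open>A \<inter> N\<close> in the
    indicator.\<close>
  have "measure M N = 0 \<or> 0 \<in> N"
    using AN[OF N_in_sets(1)] by (auto simp: emeasure_eq_measure indicator_def split: if_splits)
  then have s: "?s" using AN by (auto simp: indicator_def)
  have int: "(\<integral>\<^sup>+x\<in>A. ennreal (f x) \<partial>lborel) = (\<integral>\<^sup>+x\<in>A. ennreal (sym_density f x) \<partial>lborel)"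
    if A: "A \<in> sets M" for A
  proof -
    have "emeasure M_sym A = (\<integral>\<^sup>+x\<in>A. ennreal (sym_density f x) \<partial>lborel) + emeasure M (A \<inter> N)"
      using s A by (simp add: emeasure_sym_meas sets_M)
    then have "(\<integral>\<^sup>+x\<in>A. ennreal (f x) \<partial>lborel) + emeasure M (A \<inter> N) 
        = (\<integral>\<^sup>+x\<in>A. ennreal (sym_density f x) \<partial>lborel) + emeasure M (A \<inter> N)"
      using emeasure_decomp[OF A] eq by simp
    then show ?thesis by (simp add: emeasure_eq_measure)
  qed
  let ?I = "{-pi<..<pi} :: real set"
  have "density lborel (\<lambda>x. ennreal (f x) * indicator ?I x) 
      = density lborel (\<lambda>x. ennreal (sym_density f x) * indicator ?I x)"
  proof (rule measure_eqI)
    fix A :: "real set" assume "A \<in> sets (density lborel (\<lambda>x. ennreal (f x) * indicator ?I x))"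
    then have A: "A \<in> sets borel" by simp
    then have "A \<inter> ?I \<in> sets M" by (simp add: sets_M sets_borel_I_iff)
    from int[OF this] show "emeasure (density lborel (\<lambda>x. ennreal (f x) * indicator ?I x)) A 
        = emeasure (density lborel (\<lambda>x. ennreal (sym_density f x) * indicator ?I x)) A"
      using A by (simp add: emeasure_density indicator_inter_arith mult_ac)
  qed simp
  then have "AE x in lborel. ennreal (f x) * indicator ?I x = ennreal (sym_density f x) * indicator ?I x"
    by (intro sigma_finite_measure.density_unique[OF sigma_finite_lborel]) auto
  then have "?f"
    using AE_lborel_singleton[of 0]
  proof eventually_elim
    case (elim x)
    then show ?case using f_nonneg[of x] sym_density_nonneg[of x] by (auto simp: sym_density_def)
  qed
  with s show "?f \<and> ?s" by blast
qed

end

section \<open>Maximal chords, the integral inequality and its equality case\<close>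

text \<open>Admitting longer chords makes this antitone in \<open>x\<close> by construction. For a
  continuous concave \<open>u\<close> it is the decreasing rearrangement, with half the length as
  variable.\<close>

definition chord_sup :: "(real \<Rightarrow> real) \<Rightarrow> real \<Rightarrow> real" where
  "chord_sup u x = Sup ((\<lambda>(a, b). min (u a) (u b)) ` {(a, b). -pi \<le> a \<and> b \<le> pi \<and> 2 * x \<le> b - a})"

text \<open>A continuous function has a maximum on the compact set of admissible chords, which is
  nonempty because it contains the full chord.\<close>

lemma chord_sup_attained:
  fixes u :: "real \<Rightarrow> real"
  assumes cont: "continuous_on UNIV u" and x: "0 \<le> x" "x \<le> pi"
  obtains a b where "-pi \<le> a" "b \<le> pi" "2 * x \<le> b - a" "chord_sup u x = min (u a) (u b)"
    "\<And>c d. -pi \<le> c \<Longrightarrow> d \<le> pi \<Longrightarrow> 2 * x \<le> d - c \<Longrightarrow> min (u c) (u d) \<le> chord_sup u x"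
proof -
  let ?K = "{(a, b). -pi \<le> a \<and> b \<le> pi \<and> 2 * x \<le> b - a}" and ?m = "\<lambda>(a, b). min (u a) (u b)"
  have "?K = ({-pi..pi} \<times> {-pi..pi}) \<inter> {z. 2 * x \<le> snd z - fst z}" using x by auto
  moreover have "compact (({-pi..pi} \<times> {-pi..pi}) \<inter> {z :: real \<times> real. 2 * x \<le> snd z - fst z})"
    by (intro compact_Int_closed compact_Times compact_Icc closed_Collect_le continuous_intros)
  ultimately have "compact ?K" by simp
  moreover have "(-pi, pi) \<in> ?K" using x by simp
  then have "?K \<noteq> {}" by blast
  moreover have "continuous_on ?K ?m"
    unfolding case_prod_beta
    by (intro continuous_on_min continuous_on_compose2[OF cont] continuous_intros) auto
  ultimately obtain z where z: "z \<in> ?K" "\<And>w. w \<in> ?K \<Longrightarrow> ?m w \<le> ?m z"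
    using continuous_attains_sup[of ?K ?m] by blast
  obtain a b where ab: "z = (a, b)" by (cases z)
  have "chord_sup u x = ?m z"
    unfolding chord_sup_def by (rule cSup_eq_maximum) (use z in auto)
  then show ?thesis using that[of a b] z ab by fastforce
qed

lemma mono_abs_bound:
  fixes \<phi> :: "real \<Rightarrow> real"
  assumes "mono \<phi>" "0 \<le> z" "z \<le> C" shows "\<bar>\<phi> z\<bar> \<le> max \<bar>\<phi> 0\<bar> \<bar>\<phi> C\<bar>"
  using monoD[OF assms(1,2)] monoD[OF assms(1,3)] by linarith

lemma (in finite_measure_I) u_meas_le:
  assumes "\<bar>x\<bar> \<le> pi" shows "u_meas M x \<le> 2 * pi * measure M (space M)"
proof -
  have "u_meas M x \<le> \<bar>x - pi\<bar> * measure M (space M)" using u_meas_lipschitz[of x pi] by (simp add: u_meas_pi)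
  also have "\<dots> \<le> 2 * pi * measure M (space M)" using assms by (intro mult_right_mono) auto
  finally show ?thesis .
qed

lemma (in finite_measure_I) borel_measurable_u_meas [measurable]: "u_meas M \<in> borel_measurable borel"
  by (rule borel_measurable_continuous_onI[OF continuous_on_u_meas])

context decomposed_measure
begin

lemma u_meas_sym_abs: "u_meas M_sym \<bar>x\<bar> = u_meas M_sym x"
  by (simp add: abs_if u_meas_sym_minus)

definition u_bound :: real where
  "u_bound = max (2 * pi * measure M (space M)) (2 * pi * measure M_sym (space M_sym))"

lemma u_meas_le_bound: "\<bar>x\<bar> \<le> pi \<Longrightarrow> u_meas M x \<le> u_bound" "\<bar>x\<bar> \<le> pi \<Longrightarrow> u_meas M_sym x \<le> u_bound"
  using u_meas_le[of x] sym.u_meas_le[of x] by (auto simp: u_bound_def)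

lemma abs_phi_u_meas_le:
  fixes \<phi> :: "real \<Rightarrow> real"
  assumes "mono \<phi>" "\<bar>x\<bar> \<le> pi"
  shows "\<bar>\<phi> (u_meas M x)\<bar> \<le> max \<bar>\<phi> 0\<bar> \<bar>\<phi> u_bound\<bar>" "\<bar>\<phi> (u_meas M_sym x)\<bar> \<le> max \<bar>\<phi> 0\<bar> \<bar>\<phi> u_bound\<bar>"
  by (auto intro!: mono_abs_bound u_meas_nonneg sym.u_meas_nonneg u_meas_le_bound assms)

text \<open>A monotone \<open>\<phi>\<close> commutes with \<open>min\<close>, so the pointwise
  comparison of the potentials carries over to their compositions with
  \<open>\<phi>\<close>.\<close>

lemma integral_phi_le:
  fixes \<phi> :: "real \<Rightarrow> real"
  assumes "mono \<phi>"
  shows "(LINT x:{-pi..pi}|lborel. \<phi> (u_meas M x)) \<le> (LINT x:{-pi..pi}|lborel. \<phi> (u_meas M_sym x))"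
proof -
  have [measurable]: "\<phi> \<in> borel_measurable borel" using assms by (rule borel_measurable_mono)
  have "(LINT x:{-pi..pi}|lborel. \<phi> (u_meas M x)) \<le> (LINT x:{-pi..pi}|lborel. \<phi> (u_meas M_sym \<bar>x\<bar>))"
  proof (rule set_integral_le_of_min_le[where B="max \<bar>\<phi> 0\<bar> \<bar>\<phi> u_bound\<bar>"])
    fix a b :: real assume "-pi \<le> a" "a \<le> b" "b \<le> pi"
    then have "\<phi> (min (u_meas M a) (u_meas M b)) \<le> \<phi> (u_meas M_sym ((b - a) / 2))"
      by (intro monoD[OF assms] min_u_meas_le)
    then show "min (\<phi> (u_meas M a)) (\<phi> (u_meas M b)) \<le> \<phi> (u_meas M_sym ((b - a) / 2))"
      using min_of_mono[OF assms] by metis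
  qed (auto intro!: monoD[OF assms] u_meas_sym_antimono intro: abs_phi_u_meas_le[OF assms])
  then show ?thesis by (simp add: u_meas_sym_abs)
qed

text \<open>The function \<open>W\<close>, essentially the symmetric decreasing rearrangement of the potential,
  has \<open>\<phi> \<circ> W\<close> with an integral between the other two. Where it meets the potential of the symmetrized
  measure, the maximizing chord is centred, which pushes the original potential up to it.\<close>

lemma integral_phi_eq_imp_u_meas_eq:
  fixes \<phi> :: "real \<Rightarrow> real"
  assumes sm: "strict_mono \<phi>"
    and eq: "(LINT x:{-pi..pi}|lborel. \<phi> (u_meas M x)) = (LINT x:{-pi..pi}|lborel. \<phi> (u_meas M_sym x))"
    and x: "\<bar>x\<bar> \<le> pi"
  shows "u_meas M x = u_meas M_sym x"
proof -
  let ?u = "u_meas M" and ?v = "u_meas M_sym"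
  define B where "B = max \<bar>\<phi> 0\<bar> \<bar>\<phi> u_bound\<bar>"
  have m: "mono \<phi>" using sm by (rule strict_mono_mono)
  have [measurable]: "\<phi> \<in> borel_measurable borel" using m by (rule borel_measurable_mono)
  \<comment> \<open>Clamping the argument makes \<open>W\<close> antitone on the whole line, which
    gives measurability of \<open>\<phi> \<circ> W\<close>.\<close>
  define W where "W x = chord_sup ?u (max 0 (min pi x))" for x
  have clamp: "0 \<le> max 0 (min pi x)" "max 0 (min pi x) \<le> pi" for x :: real by auto
  note chord = chord_sup_attained[OF continuous_on_u_meas clamp]
  have W_anti: "W y \<le> W x" if "x \<le> y" for x y
  proof -
    obtain a b where ab: "-pi \<le> a" "b \<le> pi" "2 * max 0 (min pi y) \<le> b - a"
      "chord_sup ?u (max 0 (min pi y)) = min (?u a) (?u b)" using chord[of y] by metis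
    have "2 * max 0 (min pi x) \<le> b - a" using ab that by linarith
    then have "min (?u a) (?u b) \<le> W x" using chord[of x] ab unfolding W_def by metis
    then show ?thesis using ab by (simp add: W_def)
  qed
  have W_le: "0 \<le> W x" "W x \<le> ?v x" if "0 \<le> x" "x \<le> pi" for x
  proof -
    have cx: "max 0 (min pi x) = x" using that by simp
    obtain a b where ab: "-pi \<le> a" "b \<le> pi" "2 * x \<le> b - a" "W x = min (?u a) (?u b)"
      using chord[of x] unfolding W_def cx by metis
    have "min (?u a) (?u b) \<le> ?v ((b - a) / 2)" using ab that by (intro min_u_meas_le) auto
    also have "\<dots> \<le> ?v x" using ab that by (intro u_meas_sym_antimono) auto
    finally show "W x \<le> ?v x" using ab by simp
    show "0 \<le> W x" using ab that u_meas_nonneg[of a] u_meas_nonneg[of b] by auto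
  qed
  have W_bound: "\<bar>\<phi> (W x)\<bar> \<le> B" for x
  proof -
    define z where "z = max 0 (min pi x)"
    have z: "0 \<le> z" "z \<le> pi" by (auto simp: z_def)
    have "W x = W z" by (simp add: W_def z_def)
    then show ?thesis using W_le[OF z] u_meas_le_bound(2)[of z] z
      unfolding B_def by (intro mono_abs_bound[OF m]) auto
  qed
  have "mono (\<lambda>x. - \<phi> (W x))" using W_anti m by (auto simp: mono_def)
  then have "(\<lambda>x. - (- \<phi> (W x))) \<in> borel_measurable borel"
    by (intro borel_measurable_uminus borel_measurable_mono)
  then have [measurable]: "(\<lambda>x. \<phi> (W x)) \<in> borel_measurable borel" by simp
  have int: "set_integrable lborel {-pi..pi} (\<lambda>x. \<phi> (?u x))" "set_integrable lborel {-pi..pi} (\<lambda>x. \<phi> (?v x))"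
    "set_integrable lborel {-pi..pi} (\<lambda>x. \<phi> (W \<bar>x\<bar>))"
    by (rule set_integrable_bounded[where B=B]; 
        (simp add: W_bound abs_phi_u_meas_le[OF m, folded B_def])?)+
  have "(LINT x:{-pi..pi}|lborel. \<phi> (?u x)) \<le> (LINT x:{-pi..pi}|lborel. \<phi> (W \<bar>x\<bar>))"
  proof (rule set_integral_le_of_min_le[where B=B])
    fix a b :: real assume ab: "-pi \<le> a" "a \<le> b" "b \<le> pi"
    have c: "max 0 (min pi ((b - a) / 2)) = (b - a) / 2" using ab by auto
    \<comment> \<open>The chord from \<open>a\<close> to \<open>b\<close> is itself admissible at
      \<open>(b - a) / 2\<close>.\<close>
    have "min (?u a) (?u b) \<le> W ((b - a) / 2)"
      using chord[of "(b - a) / 2"] ab unfolding W_def c by (metis order_refl nonzero_mult_div_cancel_left times_divide_eq_right zero_neq_numeral)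
    then have "\<phi> (min (?u a) (?u b)) \<le> \<phi> (W ((b - a) / 2))" by (rule monoD[OF m])
    then show "min (\<phi> (?u a)) (\<phi> (?u b)) \<le> \<phi> (W ((b - a) / 2))"
      using min_of_mono[OF m] by metis
  qed (auto intro!: monoD[OF m] W_anti W_bound intro: abs_phi_u_meas_le[OF m, folded B_def])
  then have "(LINT x:{-pi..pi}|lborel. \<phi> (?v x)) \<le> (LINT x:{-pi..pi}|lborel. \<phi> (W \<bar>x\<bar>))"
    using eq by simp
  moreover have "AE x in lborel. x \<in> {-pi..pi} \<longrightarrow> \<phi> (W \<bar>x\<bar>) \<le> \<phi> (?v x)"
    using W_le(2)[of "\<bar>_\<bar>"] by (intro AE_I2 impI monoD[OF m]) (auto simp: u_meas_sym_abs abs_le_iff)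
  \<comment> \<open>Pointwise \<open>\<phi> \<circ> W\<close> is the smaller function, yet its
    integral is at least as large.\<close>
  ultimately have "AE x in lborel. x \<in> {-pi..pi} \<longrightarrow> \<phi> (W \<bar>x\<bar>) = \<phi> (?v x)"
    by (intro set_integral_eq_imp_AE_eq int)
  then have "AE x in lborel. x \<in> {-pi..pi} \<longrightarrow> ?v x \<le> ?u x"
  proof eventually_elim
    case (elim x)
    show ?case
    proof
      assume x: "x \<in> {-pi..pi}"
      define y where "y = \<bar>x\<bar>"
      have y: "0 \<le> y" "y \<le> pi" using x by (auto simp: y_def)
      have cy: "max 0 (min pi y) = y" using y by simp
      have Wv: "W y = ?v y" using elim x strict_mono_eq[OF sm] by (simp add: y_def u_meas_sym_abs)
      obtain a b where ab: "-pi \<le> a" "b \<le> pi" "2 * y \<le> b - a" "W y = min (?u a) (?u b)"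
        using chord[of y] unfolding W_def cy by metis
      \<comment> \<open>As \<open>?v y = W y\<close> is the minimum over the chord ends, this is the
        equality case of the comparison.\<close>
      have "?v ((b - a) / 2) \<le> ?v y" using ab y by (intro u_meas_sym_antimono) auto
      then have "a = - b" using ab Wv y by (intro min_u_meas_eq_imp_centred) auto
      \<comment> \<open>The centred chord has length at least \<open>2 * \<bar>x\<bar>\<close>, so
        it contains \<open>x\<close>.\<close>
      then have "min (?u a) (?u b) \<le> ?u x" using ab x by (intro u_meas_quasiconcave) (auto simp: y_def)
      then show "?v x \<le> ?u x" using ab Wv by (simp add: y_def u_meas_sym_abs)
    qed
  qed
  then have "AE x in lborel. x \<in> {-pi..pi} \<longrightarrow> \<phi> (?v x) \<le> \<phi> (?u x)"
    by eventually_elim (auto intro: monoD[OF m])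
  \<comment> \<open>The reverse pointwise inequality combined with equal integrals.\<close>
  then have "AE x in lborel. x \<in> {-pi..pi} \<longrightarrow> \<phi> (?v x) = \<phi> (?u x)"
    by (intro set_integral_eq_imp_AE_eq int) (use eq in auto)
  then have ae: "AE x in lborel. x \<in> {-pi..pi} \<longrightarrow> ?u x = ?v x"
    by eventually_elim (use strict_mono_eq[OF sm] in auto)
  show ?thesis
  proof (cases "\<bar>x\<bar> = pi")
    case True
    then have "x = pi \<or> x = -pi" by auto
    then show ?thesis by (auto simp: u_meas_pi sym.u_meas_pi)
  next
    case False
    then show ?thesis
      using x by (intro continuous_AE_eq_imp_eq[OF continuous_on_u_meas sym.continuous_on_u_meas ae]) auto
  qed
qed

end

theorem theorem1p3:
  fixes M :: "real measure" and f :: "real \<Rightarrow> real" and N :: "real set"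
  assumes sets_M: "sets M = sets borel_I"
    and fin: "finite_measure M"
    and nonzero: "emeasure M (space M) \<noteq> 0"
    and decomp: "lebesgue_decomp M f N"
  shows "(\<forall>\<phi> :: real \<Rightarrow> real. convex_on UNIV \<phi> \<and> mono \<phi> \<longrightarrow>
           (\<integral>x\<in>{-pi..pi}. \<phi> (u_meas M x) \<partial>lborel)
             \<le> (\<integral>x\<in>{-pi..pi}. \<phi> (u_meas (sym_meas f (measure M N)) x) \<partial>lborel)) \<and>
    (\<forall>\<phi> :: real \<Rightarrow> real. strict_convex_on UNIV \<phi> \<and> mono \<phi> \<longrightarrow>
           (((\<integral>x\<in>{-pi..pi}. \<phi> (u_meas M x) \<partial>lborel)
               = (\<integral>x\<in>{-pi..pi}. \<phi> (u_meas (sym_meas f (measure M N)) x) \<partial>lborel))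
            \<longleftrightarrow> ((AE x in lborel. x \<in> {-pi<..<pi} \<longrightarrow> f x = sym_rearr f x) \<and>
                 (\<forall>A \<in> sets M. emeasure M (A \<inter> N) = ennreal (measure M N) * indicator A 0)))) \<and>
    (((AE x in lborel. x \<in> {-pi<..<pi} \<longrightarrow> f x = sym_rearr f x) \<and>
          (\<forall>A \<in> sets M. emeasure M (A \<inter> N) = ennreal (measure M N) * indicator A 0))
         \<longleftrightarrow> M = sym_meas f (measure M N))"
proof -
  interpret decomposed_measure M f N
    using assms by (simp add: decomposed_measure_def decomposed_measure_axioms_def
        finite_measure_I_def finite_measure_I_axioms_def)
  have "M = M_sym"
    if "strict_convex_on UNIV \<phi>" "mono \<phi>"
      "(LINT x:{-pi..pi}|lborel. \<phi> (u_meas M x)) = (LINT x:{-pi..pi}|lborel. \<phi> (u_meas M_sym x))" for \<phi>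
    using integral_phi_eq_imp_u_meas_eq[OF strict_convex_mono_imp_strict_mono[OF that(1,2)] that(3)]
    by (intro u_meas_determines_measure finite_measure_I_axioms sym.finite_measure_I_axioms)
  \<comment> \<open>After rewriting, the equality condition reads \<open>M = M_sym\<close>, under
    which the two integrals coincide.\<close>
  then show ?thesis unfolding eq_sym_meas_iff using integral_phi_le by auto
qed

end
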